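(* Let $\mathfrak{M}=(V,\langle\cdot,\cdot\rangle,A)$, where $V$ is a finite-dimensional real vector space with $\dim V\ge 3$, $\langle\cdot,\cdot\rangle$ is a non-degenerate symmetric bilinear form on $V$, and $A$ is an algebraic curvature tensor on $V$. The following statements are equivalent: (1) $\mathfrak{M}$ is $2$-step Jacobi nilpotent and indecomposable. (2) $\mathfrak{M}$ is $2$-step skew-curvature nilpotent and indecomposable. (3) There exist a finite-dimensional real vector space $W$ and an algebraic curvature tensor $A_W$ on $W$ such that $(W,A_W)$ is indecomposable and $\mathfrak{M}$ is isomorphic to the doubled model $\mathfrak{M}(W,A_W)$.
   Context: An algebraic curvature tensor on a real vector space $V$ is $A\in\otimes^4V^*$ with $A(x,y,z,w)=-A(y,x,z,w)=A(z,w,x,y)$ and $A(x,y,z,w)+A(y,z,x,w)+A(z,x,y,w)=0$ for all $x,y,z,w\in V$. The curvature operator $\mathcal{A}(x,y)\in\operatorname{End}(V)$ is defined by $\langle\mathcal{A}(x,y)z,w\rangle=A(x,y,z,w)$, and the Jacobi operator is $\mathcal{J}(x):y\mapsto\mathcal{A}(y,x)x$. $\mathfrak{M}$ is $2$-step Jacobi nilpotent if $\mathcal{J}(x)\mathcal{J}(y)=0$ for all $x,y\in V$. $\mathfrak{M}$ is $2$-step skew-curvature nilpotent if $\mathcal{A}(x_1,x_2)\mathcal{A}(x_3,x_4)=0$ for all $x_1,x_2,x_3,x_4\in V$. Indecomposability: $(W,A_W)$ (no inner product) is indecomposable if there is no decomposition $(W,A_W)=(W_1,A_1)\oplus(W_2,A_2)$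 with $\dim W_i\ge1$, i.e. no direct sum $W=W_1\oplus W_2$ with $\dim W_i\ge 1$ such that $A_W=A_1\oplus A_2$ for algebraic curvature tensors $A_i$ on $W_i$ (so $A_W$ vanishes whenever its arguments include a vector of $W_1$ and a vector of $W_2$). $\mathfrak{M}$ is indecomposable if there is no decomposition $\mathfrak{M}=\mathfrak{M}_1\oplus\mathfrak{M}_2$ with $\mathfrak{M}_i=(V_i,\langle\cdot,\cdot\rangle_i,A_i)$ and $\dim V_i\ge1$, where the direct sum is orthogonal with respect to the inner product and $A=A_1\oplus A_2$. Doubled model: let $\{e_1,\dots,e_k\}$ be a basis of $W$ and $\{\bar e_1,\dots,\bar e_k\}$ a basis of an auxiliary vector space $\bar W$. Then $\mathfrak{M}(W,A_W):=(W\oplus\bar W,\langle\cdot,\cdot\rangle_{W\oplus\bar W},A_W\oplus0)$, where $\langle e_i,e_j\rangle=\langle\bar e_i,\bar e_j\rangle=0$, $\langle e_i,\bar e_j\rangle=\delta_{ij}$, and $A_W\oplus 0$ equals $A_W$ on $W$ and vanishes if any argument lies in $\bar W$. An isomorphism is a linear isomorphism preserving both the inner products and the algebraic curvature tensors. *)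

theory Defs
  imports "HOL-Analysis.Analysis"
begin

text \<open>Vector spaces are linear subspaces of a type of class \<open>real_vector\<close>. Forms, tensors and maps
  are total functions of which only the values on the subspace matter; every condition below is
  relativised to the subspace.\<close>

definition fin_dim_subspace :: "'v::real_vector set \<Rightarrow> bool" where
  "fin_dim_subspace V \<longleftrightarrow> subspace V \<and> (\<exists>B. finite B \<and> span B = V)"

definition finite_basis :: "'v::real_vector set \<Rightarrow> 'v set \<Rightarrow> bool" where
  "finite_basis V B \<longleftrightarrow> finite B \<and> independent B \<and> span B = V"

definition linear_on_subspace ::
    "'v::real_vector set \<Rightarrow> ('v \<Rightarrow> 'w::real_vector) \<Rightarrow> bool" where
  "linear_on_subspace V f \<longleftrightarrow>
     (\<forall>x\<in>V. \<forall>y\<in>V. f (x + y) = f x + f y) \<and> (\<forall>c. \<forall>x\<in>V. f (c *\<^sub>R x) = c *\<^sub>R f x)"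

definition is_direct_sum ::
    "'v::real_vector set \<Rightarrow> 'v set \<Rightarrow> 'v set \<Rightarrow> bool" where
  "is_direct_sum V V1 V2 \<longleftrightarrow>
     subspace V1 \<and> subspace V2 \<and> V1 \<inter> V2 = {0} \<and> V = {x + y | x y. x \<in> V1 \<and> y \<in> V2}"

type_synonym 'v form2 = "'v \<Rightarrow> 'v \<Rightarrow> real"
type_synonym 'v form4 = "'v \<Rightarrow> 'v \<Rightarrow> 'v \<Rightarrow> 'v \<Rightarrow> real"

definition inner_product_on :: "'v::real_vector set \<Rightarrow> 'v form2 \<Rightarrow> bool" where
  "inner_product_on V g \<longleftrightarrow>
     (\<forall>x\<in>V. linear_on_subspace V (\<lambda>y. g x y)) \<and>
     (\<forall>y\<in>V. linear_on_subspace V (\<lambda>x. g x y)) \<and>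
     (\<forall>x\<in>V. \<forall>y\<in>V. g x y = g y x) \<and>
     (\<forall>x\<in>V. (\<forall>y\<in>V. g x y = 0) \<longrightarrow> x = 0)"

definition multilinear4_on :: "'v::real_vector set \<Rightarrow> 'v form4 \<Rightarrow> bool" where
  "multilinear4_on V A \<longleftrightarrow>
     (\<forall>x\<in>V. \<forall>y\<in>V. \<forall>z\<in>V.
        linear_on_subspace V (\<lambda>u. A u x y z) \<and> linear_on_subspace V (\<lambda>u. A x u y z) \<and>
        linear_on_subspace V (\<lambda>u. A x y u z) \<and> linear_on_subspace V (\<lambda>u. A x y z u))"

definition alg_curv_tensor :: "'v::real_vector set \<Rightarrow> 'v form4 \<Rightarrow> bool" where
  "alg_curv_tensor V A \<longleftrightarrow>
     multilinear4_on V A \<and>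
     (\<forall>x\<in>V. \<forall>y\<in>V. \<forall>z\<in>V. \<forall>w\<in>V.
        A x y z w = - A y x z w \<and> A x y z w = A z w x y \<and>
        A x y z w + A y z x w + A z x y w = 0)"

definition tensor_splits ::
    "'v::real_vector set \<Rightarrow> 'v set \<Rightarrow> 'v form4 \<Rightarrow> 'v form4 \<Rightarrow> 'v form4 \<Rightarrow> bool" where
  "tensor_splits V1 V2 A A1 A2 \<longleftrightarrow>
     (\<forall>x1\<in>V1. \<forall>y1\<in>V1. \<forall>z1\<in>V1. \<forall>w1\<in>V1. \<forall>x2\<in>V2. \<forall>y2\<in>V2. \<forall>z2\<in>V2. \<forall>w2\<in>V2.
        A (x1 + x2) (y1 + y2) (z1 + z2) (w1 + w2) = A1 x1 y1 z1 w1 + A2 x2 y2 z2 w2)"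

definition indecomposable_curv :: "'v::real_vector set \<Rightarrow> 'v form4 \<Rightarrow> bool" where
  "indecomposable_curv W A \<longleftrightarrow>
     \<not> (\<exists>W1 W2 A1 A2. is_direct_sum W W1 W2 \<and> dim W1 \<ge> 1 \<and> dim W2 \<ge> 1 \<and>
          alg_curv_tensor W1 A1 \<and> alg_curv_tensor W2 A2 \<and> tensor_splits W1 W2 A A1 A2)"

record 'v curv_model =
  space_of :: "'v set"
  form_of :: "'v form2"
  curv_of :: "'v form4"

definition is_model :: "'v::real_vector curv_model \<Rightarrow> bool" where
  "is_model M \<longleftrightarrow> fin_dim_subspace (space_of M) \<and> inner_product_on (space_of M) (form_of M) \<and>
     alg_curv_tensor (space_of M) (curv_of M)"

definition model_splits ::
    "'v::real_vector curv_model \<Rightarrow> 'v curv_model \<Rightarrow> 'v curv_model \<Rightarrow> bool" where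
  "model_splits M M1 M2 \<longleftrightarrow>
     is_direct_sum (space_of M) (space_of M1) (space_of M2) \<and>
     (\<forall>x1\<in>space_of M1. \<forall>y1\<in>space_of M1. \<forall>x2\<in>space_of M2. \<forall>y2\<in>space_of M2.
        form_of M (x1 + x2) (y1 + y2) = form_of M1 x1 y1 + form_of M2 x2 y2) \<and>
     tensor_splits (space_of M1) (space_of M2) (curv_of M) (curv_of M1) (curv_of M2)"

definition indecomposable_model :: "'v::real_vector curv_model \<Rightarrow> bool" where
  "indecomposable_model M \<longleftrightarrow>
     \<not> (\<exists>M1 M2. is_model M1 \<and> is_model M2 \<and> dim (space_of M1) \<ge> 1 \<and> dim (space_of M2) \<ge> 1 \<and>
          model_splits M M1 M2)"

definition curv_operator :: "'v::real_vector curv_model \<Rightarrow> 'v \<Rightarrow> 'v \<Rightarrow> 'v \<Rightarrow> 'v" where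
  "curv_operator M x y z =
     (THE v. v \<in> space_of M \<and> (\<forall>w\<in>space_of M. form_of M v w = curv_of M x y z w))"

definition jacobi_operator :: "'v::real_vector curv_model \<Rightarrow> 'v \<Rightarrow> 'v \<Rightarrow> 'v" where
  "jacobi_operator M x y = curv_operator M y x x"

definition two_step_jacobi_nilpotent :: "'v::real_vector curv_model \<Rightarrow> bool" where
  "two_step_jacobi_nilpotent M \<longleftrightarrow>
     (\<forall>x\<in>space_of M. \<forall>y\<in>space_of M. \<forall>v\<in>space_of M.
        jacobi_operator M x (jacobi_operator M y v) = 0)"

definition two_step_skew_curvature_nilpotent :: "'v::real_vector curv_model \<Rightarrow> bool" where
  "two_step_skew_curvature_nilpotent M \<longleftrightarrow>
     (\<forall>x1\<in>space_of M. \<forall>x2\<in>space_of M. \<forall>x3\<in>space_of M. \<forall>x4\<in>space_of M. \<forall>v\<in>space_of M.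
        curv_operator M x1 x2 (curv_operator M x3 x4 v) = 0)"

definition isomorphic_models ::
    "'v::real_vector curv_model \<Rightarrow> 'w::real_vector curv_model \<Rightarrow> bool" where
  "isomorphic_models M N \<longleftrightarrow>
     (\<exists>f. linear_on_subspace (space_of M) f \<and> bij_betw f (space_of M) (space_of N) \<and>
        (\<forall>x\<in>space_of M. \<forall>y\<in>space_of M. form_of N (f x) (f y) = form_of M x y) \<and>
        (\<forall>x\<in>space_of M. \<forall>y\<in>space_of M. \<forall>z\<in>space_of M. \<forall>w\<in>space_of M.
           curv_of N (f x) (f y) (f z) (f w) = curv_of M x y z w))"

text \<open>The auxiliary space of the doubled model is a second copy of \<open>W\<close>: for \<open>e\<close> in the basis \<open>B\<close>
  of \<open>W\<close>, the basis vector \<open>e\<close> is \<open>(e, 0)\<close> and its barred partner is \<open>(0, e)\<close>. The form is the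
  bilinear extension of the relations proved in \<open>doubled_model_form_basis\<close>.\<close>

definition doubled_model ::
    "'w::real_vector set \<Rightarrow> 'w form4 \<Rightarrow> 'w set \<Rightarrow> ('w \<times> 'w) curv_model" where
  "doubled_model W A B = \<lparr>
     space_of = W \<times> W,
     form_of = (\<lambda>p q. \<Sum>e\<in>B.
        representation B (fst p) e * representation B (snd q) e +
        representation B (snd p) e * representation B (fst q) e),
     curv_of = (\<lambda>p q r s. A (fst p) (fst q) (fst r) (fst s)) \<rparr>"

lemma doubled_model_form_basis:
  assumes B: "finite_basis W B" and e: "e \<in> B" and e': "e' \<in> B"
  shows "form_of (doubled_model W A B) (e, 0) (e', 0) = 0"
    and "form_of (doubled_model W A B) (0, e) (0, e') = 0"
    and "form_of (doubled_model W A B) (e, 0) (0, e') = (if e = e' then 1 else 0)"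
    and "form_of (doubled_model W A B) (0, e) (e', 0) = (if e = e' then 1 else 0)"
proof -
  have r: "representation B b = (\<lambda>v. if v = b then 1 else 0)" if "b \<in> B" for b
    using B that by (simp add: finite_basis_def representation_basis)
  have "(\<Sum>b\<in>B. (if b = e then 1 else 0) * (if b = e' then 1 else 0 :: real))
      = (\<Sum>b\<in>B. if b = e then (if e = e' then 1 else 0) else 0)"
    by (rule sum.cong) auto
  also have "\<dots> = (if e = e' then 1 else 0)"
    using B e by (simp add: finite_basis_def)
  finally have s: "(\<Sum>b\<in>B. (if b = e then 1 else 0) * (if b = e' then 1 else 0 :: real))
      = (if e = e' then 1 else 0)" .
  show "form_of (doubled_model W A B) (e, 0) (e', 0) = 0"
    and "form_of (doubled_model W A B) (0, e) (0, e') = 0"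
    and "form_of (doubled_model W A B) (e, 0) (0, e') = (if e = e' then 1 else 0)"
    and "form_of (doubled_model W A B) (0, e) (e', 0) = (if e = e' then 1 else 0)"
    by (simp_all only: doubled_model_def curv_model.simps fst_conv snd_conv r[OF e] r[OF e'] s
        representation_zero mult_zero_left mult_zero_right add_0_left add_0_right sum.neutral_const)
qed

definition is_indecomposable_double ::
    "'v::real_vector curv_model \<Rightarrow> 'w::real_vector set \<Rightarrow> 'w form4 \<Rightarrow> bool" where
  "is_indecomposable_double M W A \<longleftrightarrow>
     fin_dim_subspace W \<and> alg_curv_tensor W A \<and> indecomposable_curv W A \<and>
     (\<exists>B. finite_basis W B \<and> isomorphic_models M (doubled_model W A B))"

end

theory Submission
  imports Defs
begin

text \<open>Both nilpotency conditions say that the span \<open>R\<close> of the ranges of the curvature operators is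
  totally isotropic, since the curvature operators are recovered from the Jacobi operators by
  polarisation. The orthogonal complement of \<open>R\<close> is the kernel \<open>K\<close> of \<open>A\<close>. A non-null vector of
  \<open>K\<close> spans an orthogonal summand, so indecomposability forces \<open>K\<close> to be totally isotropic; then
  \<open>K\<close> is Lagrangian, and an isotropic complement \<open>W\<close> dual to \<open>K\<close> exhibits the model as the double
  of \<open>(W, A)\<close>. Conversely, the projection of a double onto \<open>W\<close> has the Lagrangian kernel \<open>K\<close>, so a
  splitting of the double, whose summands are non-degenerate and hence not contained in \<open>K\<close>,
  projects to a splitting of \<open>W\<close>.\<close>

section \<open>Subspaces and direct sums\<close>

text \<open>The dimension bound is aimed at a one-dimensional \<open>W\<close>. Its tensor is zero
  and it is indecomposable, yet its double is a hyperbolic plane with zero curvature, which splits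
  into two orthogonal non-null lines. Once \<open>W\<close> is not a line, indecomposability forces
  the kernel of \<open>A\<^sub>W\<close> to be zero, and this is what keeps the projection of a
  splitting of the double a direct sum.

  The span \<open>R\<close> is never formed and no dimensions of complements are counted. That the
  kernel is its own orthogonal complement is obtained as two inclusions: isotropy is one, and for
  the other a vector orthogonal to the kernel is orthogonal to all ranges of curvature operators,
  which by the symmetries of the tensor places it in the kernel.

  Lifting a splitting of \<open>W\<close> to the double cannot be done by taking each summand
  together with its barred copy, because the pairing of \<open>W\<close> with the barred copy
  depends on a basis that need not be adapted to the splitting. The barred copy plays the role of
  the dual space, so \<open>W1\<close> has to be matched with the annihilator of
  \<open>W2\<close>.\<close>

lemma fin_dim_subspaceD: "fin_dim_subspace V \<Longrightarrow> subspace V"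
  by (simp add: fin_dim_subspace_def)

lemma fin_dim_subspace_subset:
  assumes V: "fin_dim_subspace V" and U: "subspace U" "U \<subseteq> V"
  obtains E where "finite_basis U E" "card E = dim U"
proof -
  obtain T where T: "finite T" "span T = V"
    using V by (auto simp: fin_dim_subspace_def)
  obtain E where E: "E \<subseteq> U" "independent E" "U \<subseteq> span E" "card E = dim U"
    by (rule basis_exists[of U])
  have "finite E"
    using independent_span_bound[OF T(1) E(2)] E(1) U(2) T(2) by auto
  moreover have "span E = U"
    using E U(1) by (metis span_minimal subset_antisym)
  ultimately show thesis
    using E that by (auto simp: finite_basis_def)
qed

lemma finite_basis_exists:
  assumes "fin_dim_subspace V"
  obtains E where "finite_basis V E" "card E = dim V"
  using fin_dim_subspace_subset[OF assms fin_dim_subspaceD[OF assms] order_refl] by blast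

lemma fin_dim_subspace_mono:
  assumes "fin_dim_subspace V" "subspace U" "U \<subseteq> V"
  shows "fin_dim_subspace U"
proof -
  obtain E where "finite_basis U E" using fin_dim_subspace_subset[OF assms] .
  then show ?thesis using assms(2) by (auto simp: fin_dim_subspace_def finite_basis_def)
qed

text \<open>\<open>dim\<close> is the cardinality of a basis, hence 0 on an infinite-dimensional
  space; finiteness makes it detect nonzero vectors.\<close>

lemma dim_ge_1_iff:
  assumes "fin_dim_subspace V"
  shows "dim V \<ge> 1 \<longleftrightarrow> V \<noteq> {0}"
proof -
  obtain E where E: "finite_basis V E" "card E = dim V"
    using finite_basis_exists[OF assms] .
  have "card E \<ge> 1 \<longleftrightarrow> E \<noteq> {}"
    using E(1) by (simp add: finite_basis_def Suc_le_eq card_gt_0_iff)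
  moreover have "E \<noteq> {} \<longleftrightarrow> V \<noteq> {0}"
  proof
    assume "E \<noteq> {}"
    then obtain b where b: "b \<in> E" by blast
    then have "b \<noteq> 0" "b \<in> V"
      using E(1) dependent_zero span_base unfolding finite_basis_def by metis+
    then show "V \<noteq> {0}" by blast
  next
    assume "V \<noteq> {0}" then show "E \<noteq> {}"
      using E(1) by (auto simp: finite_basis_def)
  qed
  ultimately show ?thesis using E(2) by simp
qed

text \<open>Links maps controlled only on \<open>V\<close> to maps linear on the whole type: the
  values on a basis of \<open>V\<close> determine an extension. The facts below about sums and about
  equality on a basis pass through it.\<close>

lemma linear_on_subspace_extend:
  assumes "subspace V" and "linear_on_subspace V f"
  obtains h where "linear h" "\<And>x. x \<in> V \<Longrightarrow> h x = f x"
proof -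
  obtain E where E: "E \<subseteq> V" "independent E" "V \<subseteq> span E" "card E = dim V"
    by (rule basis_exists[of V])
  obtain h where h: "linear h" "\<forall>x\<in>E. h x = f x"
    using linear_independent_extend[OF E(2)] by blast
  have "h x = f x \<and> x \<in> V" if "x \<in> span E" for x
    using that
  proof (induction rule: span_induct_alt)
    case base
    have "f (0 *\<^sub>R 0) = 0 *\<^sub>R f 0"
      using assms by (metis linear_on_subspace_def subspace_0)
    then show ?case using h(1) assms(1) by (simp add: linear_0 subspace_0)
  next
    case (step c x y)
    moreover have "c *\<^sub>R x \<in> V" "x \<in> V" using step E assms(1) by (auto simp: subspace_scale)
    ultimately show ?case
      using h assms by (simp add: linear_add linear_scale linear_on_subspace_def subspace_add)
  qed
  with E h that show thesis by blast
qed

lemma linear_on_subspace_0: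
  "subspace V \<Longrightarrow> linear_on_subspace V f \<Longrightarrow> f 0 = 0"
  by (metis linear_on_subspace_extend linear_0 subspace_0)

lemma linear_on_subspace_sum:
  assumes "subspace V" "linear_on_subspace V f" "\<And>i. i \<in> I \<Longrightarrow> x i \<in> V"
  shows "f (\<Sum>i\<in>I. c i *\<^sub>R x i) = (\<Sum>i\<in>I. c i *\<^sub>R f (x i))"
proof -
  obtain h where h: "linear h" "\<And>x. x \<in> V \<Longrightarrow> h x = f x"
    using linear_on_subspace_extend[OF assms(1,2)] by blast
  have "f (\<Sum>i\<in>I. c i *\<^sub>R x i) = h (\<Sum>i\<in>I. c i *\<^sub>R x i)"
    using assms by (simp add: h(2) subspace_sum subspace_scale)
  also have "\<dots> = (\<Sum>i\<in>I. c i *\<^sub>R h (x i))"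
    using h(1) by (simp add: linear_sum linear_scale)
  also have "\<dots> = (\<Sum>i\<in>I. c i *\<^sub>R f (x i))"
    using assms(3) h(2) by simp
  finally show ?thesis .
qed

lemma linear_on_subspace_eqI:
  assumes "finite_basis V B" and "linear_on_subspace V f" "linear_on_subspace V h"
    and "\<And>b. b \<in> B \<Longrightarrow> f b = h b" and "x \<in> V"
  shows "f x = h x"
proof -
  have V: "subspace V" "V = span B" using assms(1) by (auto simp: finite_basis_def)
  obtain f' where f': "linear f'" "\<And>x. x \<in> V \<Longrightarrow> f' x = f x"
    using linear_on_subspace_extend[OF V(1) assms(2)] by blast
  obtain h' where h': "linear h'" "\<And>x. x \<in> V \<Longrightarrow> h' x = h x"
    using linear_on_subspace_extend[OF V(1) assms(3)] by blast
  have "f' x = h' x"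
    using linear_eq_on_span[OF f'(1) h'(1), of B x] assms(4,5) f' h' V span_base by metis
  then show ?thesis using assms(5) f' h' by simp
qed

lemma linear_on_subspace_subset:
  "linear_on_subspace V f \<Longrightarrow> U \<subseteq> V \<Longrightarrow> linear_on_subspace U f"
  unfolding linear_on_subspace_def by blast

lemma is_direct_sum_decompose:
  assumes "is_direct_sum V V1 V2" "x \<in> V"
  obtains a b where "a \<in> V1" "b \<in> V2" "x = a + b"
proof -
  have "x \<in> {x + y | x y. x \<in> V1 \<and> y \<in> V2}" using assms by (simp add: is_direct_sum_def)
  with that show thesis by blast
qed

lemma is_direct_sum_add:
  assumes "is_direct_sum V V1 V2" "a \<in> V1" "b \<in> V2"
  shows "a + b \<in> V"
proof -
  have "V = {x + y | x y. x \<in> V1 \<and> y \<in> V2}" using assms(1) by (simp add: is_direct_sum_def)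
  moreover have "a + b \<in> {x + y | x y. x \<in> V1 \<and> y \<in> V2}" using assms(2,3) by blast
  ultimately show ?thesis by (rule ssubst)
qed

lemma is_direct_sum_subset:
  assumes "is_direct_sum V V1 V2"
  shows "V1 \<subseteq> V" "V2 \<subseteq> V"
proof -
  have 0: "0 \<in> V1" "0 \<in> V2"
    using assms by (simp_all add: is_direct_sum_def subspace_0)
  show "V1 \<subseteq> V" using is_direct_sum_add[OF assms _ 0(2)] by auto
  show "V2 \<subseteq> V" using is_direct_sum_add[OF assms 0(1)] by auto
qed

lemma is_direct_sumI:
  assumes "subspace V1" "subspace V2" and "\<And>x. x \<in> V1 \<Longrightarrow> x \<in> V2 \<Longrightarrow> x = 0"
    and "\<And>a b. a \<in> V1 \<Longrightarrow> b \<in> V2 \<Longrightarrow> a + b \<in> V"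
    and "\<And>x. x \<in> V \<Longrightarrow> \<exists>a\<in>V1. \<exists>b\<in>V2. x = a + b"
  shows "is_direct_sum V V1 V2"
proof -
  have "V1 \<inter> V2 = {0}"
    using assms(3) subspace_0[OF assms(1)] subspace_0[OF assms(2)] by blast
  moreover have "V = {x + y | x y. x \<in> V1 \<and> y \<in> V2}"
    using assms(4,5) by (intro set_eqI iffI) blast+
  ultimately show ?thesis using assms(1,2) unfolding is_direct_sum_def by blast
qed

lemma is_direct_sum_commute: "is_direct_sum U V1 V2 \<Longrightarrow> is_direct_sum U V2 V1"
  unfolding is_direct_sum_def by (auto simp: Int_commute) (metis add.commute)+

lemma is_direct_sum_projection:
  assumes V: "is_direct_sum V V1 V2"
  obtains \<pi> where "linear_on_subspace V \<pi>"
    "\<And>x. x \<in> V \<Longrightarrow> \<pi> x \<in> V1" "\<And>x. x \<in> V \<Longrightarrow> x - \<pi> x \<in> V2"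
    "\<And>x. x \<in> V1 \<Longrightarrow> \<pi> x = x" "\<And>x. x \<in> V2 \<Longrightarrow> \<pi> x = 0"
proof -
  have sub: "subspace V1" "subspace V2" and int: "V1 \<inter> V2 = {0}"
    using V by (simp_all add: is_direct_sum_def)
  have "\<exists>y\<in>V1. x - y \<in> V2" if "x \<in> V" for x
  proof -
    obtain a b where "a \<in> V1" "b \<in> V2" "x = a + b"
      using V \<open>x \<in> V\<close> by (rule is_direct_sum_decompose)
    then show ?thesis by (intro bexI[of _ a]) simp_all
  qed
  then obtain \<pi> where \<pi>: "\<And>x. x \<in> V \<Longrightarrow> \<pi> x \<in> V1" "\<And>x. x \<in> V \<Longrightarrow> x - \<pi> x \<in> V2"
    by metis
  have unique: "\<pi> x = y" if "x \<in> V" "y \<in> V1" "x - y \<in> V2" for x y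
  proof -
    have "\<pi> x - y \<in> V1" using that \<pi>(1) sub(1) by (simp add: subspace_diff)
    moreover have "(x - y) - (x - \<pi> x) \<in> V2"
      using that \<pi>(2) sub(2) by (simp only: subspace_diff)
    ultimately have "\<pi> x - y \<in> V1 \<inter> V2" by simp
    then show ?thesis using int by simp
  qed
  note V12 = is_direct_sum_subset[OF V]
  \<comment> \<open>\<open>is_direct_sum\<close> does not state that \<open>V\<close> is a subspace;
    closure under the operations is inherited from the two summands.\<close>
  have subV: "x + y \<in> V" if "x \<in> V" "y \<in> V" for x y
  proof -
    have "\<pi> x + \<pi> y \<in> V1" "(x - \<pi> x) + (y - \<pi> y) \<in> V2"
      using that \<pi> sub by (simp_all only: subspace_add)
    then have "(\<pi> x + \<pi> y) + ((x - \<pi> x) + (y - \<pi> y)) \<in> V"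
      by (rule is_direct_sum_add[OF V])
    then show ?thesis by simp
  qed
  have scaleV: "c *\<^sub>R x \<in> V" if "x \<in> V" for c x
  proof -
    have "c *\<^sub>R \<pi> x \<in> V1" "c *\<^sub>R (x - \<pi> x) \<in> V2"
      using that \<pi> sub by (simp_all only: subspace_scale)
    then have "c *\<^sub>R \<pi> x + c *\<^sub>R (x - \<pi> x) \<in> V"
      by (rule is_direct_sum_add[OF V])
    then show ?thesis by (simp add: algebra_simps)
  qed
  have "\<pi> (x + y) = \<pi> x + \<pi> y" if "x \<in> V" "y \<in> V" for x y
  proof (rule unique)
    show "x + y \<in> V" using that by (rule subV)
    show "\<pi> x + \<pi> y \<in> V1" using that \<pi> sub by (simp add: subspace_add)
    have "(x - \<pi> x) + (y - \<pi> y) \<in> V2" using that \<pi> sub by (simp only: subspace_add)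
    then show "x + y - (\<pi> x + \<pi> y) \<in> V2" by (simp add: algebra_simps)
  qed
  moreover have "\<pi> (c *\<^sub>R x) = c *\<^sub>R \<pi> x" if "x \<in> V" for c x
  proof (rule unique)
    show "c *\<^sub>R x \<in> V" using that by (rule scaleV)
    show "c *\<^sub>R \<pi> x \<in> V1" using that \<pi> sub by (simp add: subspace_scale)
    have "c *\<^sub>R (x - \<pi> x) \<in> V2" using that \<pi> sub by (simp only: subspace_scale)
    then show "c *\<^sub>R x - c *\<^sub>R \<pi> x \<in> V2" by (simp add: algebra_simps)
  qed
  ultimately have "linear_on_subspace V \<pi>" by (simp add: linear_on_subspace_def)
  moreover have "\<pi> x = x" if "x \<in> V1" for x
    by (rule unique) (use that V12 sub in \<open>auto simp: subspace_0\<close>)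
  moreover have "\<pi> x = 0" if "x \<in> V2" for x
    by (rule unique) (use that V12 sub in \<open>auto simp: subspace_0\<close>)
  ultimately show thesis using that \<pi> by blast
qed

text \<open>A vector of \<open>B\<close> outside \<open>span S\<close> would enlarge
  \<open>S\<close> to an independent set with more elements than the spanning set \<open>B\<close>.
  This replaces a rank argument when an injective endomorphism is shown to be onto.\<close>

lemma span_eq_if_independent_card:
  assumes "finite B" "independent S" "S \<subseteq> span B" "card S = card B"
  shows "span S = span B"
proof -
  have "finite S" using independent_span_bound[OF assms(1-3)] by simp
  have "b \<in> span S" if "b \<in> B" for b
  proof (rule ccontr)
    assume b: "b \<notin> span S"
    then have "independent (insert b S)" using assms(2) by (simp add: independent_insertI)
    moreover have "insert b S \<subseteq> span B" using assms(3) that by (simp add: span_base)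
    ultimately have "card (insert b S) \<le> card B"
      using independent_span_bound[OF assms(1)] by blast
    moreover have "b \<notin> S" using b span_base by blast
    ultimately show False using \<open>finite S\<close> assms(4) by simp
  qed
  then show ?thesis using assms(3) by (simp add: span_minimal subsetI subset_antisym)
qed

section \<open>Non-degenerate forms\<close>

locale scalar_product_space =
  fixes V :: "'v::real_vector set" and g :: "'v form2"
  assumes fin_dim: "fin_dim_subspace V" and inner_product: "inner_product_on V g"
begin

lemma sub: "subspace V"
  using fin_dim by (rule fin_dim_subspaceD)

lemma form_linear_right: "x \<in> V \<Longrightarrow> linear_on_subspace V (g x)"
  using inner_product by (simp add: inner_product_on_def)

lemma form_linear_left: "y \<in> V \<Longrightarrow> linear_on_subspace V (\<lambda>x. g x y)"
  using inner_product by (simp add: inner_product_on_def)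

lemma form_commute: "x \<in> V \<Longrightarrow> y \<in> V \<Longrightarrow> g x y = g y x"
  using inner_product by (simp add: inner_product_on_def)

lemma form_nondegenerate: "x \<in> V \<Longrightarrow> (\<And>y. y \<in> V \<Longrightarrow> g x y = 0) \<Longrightarrow> x = 0"
  using inner_product by (simp add: inner_product_on_def)

lemma form_add:
  "x \<in> V \<Longrightarrow> y \<in> V \<Longrightarrow> z \<in> V \<Longrightarrow> g (x + y) z = g x z + g y z"
  "x \<in> V \<Longrightarrow> y \<in> V \<Longrightarrow> z \<in> V \<Longrightarrow> g z (x + y) = g z x + g z y"
  using form_linear_left form_linear_right by (simp_all add: linear_on_subspace_def)

lemma form_scale:
  "x \<in> V \<Longrightarrow> z \<in> V \<Longrightarrow> g (c *\<^sub>R x) z = c * g x z"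
  "x \<in> V \<Longrightarrow> z \<in> V \<Longrightarrow> g z (c *\<^sub>R x) = c * g z x"
  using form_linear_left form_linear_right by (simp_all add: linear_on_subspace_def)

lemma form_diff:
  "x \<in> V \<Longrightarrow> y \<in> V \<Longrightarrow> z \<in> V \<Longrightarrow> g (x - y) z = g x z - g y z"
  "x \<in> V \<Longrightarrow> y \<in> V \<Longrightarrow> z \<in> V \<Longrightarrow> g z (x - y) = g z x - g z y"
  using form_add[of x "(-1) *\<^sub>R y" z] form_scale[of y z "-1"] sub
  by (simp_all add: subspace_neg)

lemma form_zero: "z \<in> V \<Longrightarrow> g 0 z = 0" "z \<in> V \<Longrightarrow> g z 0 = 0"
  using form_linear_left form_linear_right linear_on_subspace_0 sub by blast+

lemma form_sum:
  assumes "\<And>i. i \<in> I \<Longrightarrow> x i \<in> V" "z \<in> V"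
  shows "g (\<Sum>i\<in>I. c i *\<^sub>R x i) z = (\<Sum>i\<in>I. c i * g (x i) z)"
    and "g z (\<Sum>i\<in>I. c i *\<^sub>R x i) = (\<Sum>i\<in>I. c i * g z (x i))"
  using linear_on_subspace_sum[OF sub form_linear_left[OF assms(2)] assms(1)]
    linear_on_subspace_sum[OF sub form_linear_right[OF assms(2)] assms(1)] by auto

lemma form_eqI:
  "x \<in> V \<Longrightarrow> y \<in> V \<Longrightarrow> (\<And>z. z \<in> V \<Longrightarrow> g x z = g y z) \<Longrightarrow> x = y"
  using form_nondegenerate[of "x - y"] sub by (simp add: form_diff subspace_diff)

text \<open>Riesz representation: the injective map \<open>v \<mapsto> (\<Sum>b\<in>B. g v b *\<^sub>R b)\<close> of the
  finite-dimensional space \<open>V\<close> into itself is onto.\<close>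

lemma form_representation_basis:
  assumes B: "finite_basis V B"
  obtains v where "v \<in> V" "\<And>b. b \<in> B \<Longrightarrow> g v b = \<phi> b"
proof -
  have B': "finite B" "independent B" "span B = V" "\<And>b. b \<in> B \<Longrightarrow> b \<in> V"
    using B by (auto simp: finite_basis_def span_base)
  define T where "T v = (\<Sum>b\<in>B. g v b *\<^sub>R b)" for v
  have T_in: "T v \<in> V" for v
    unfolding T_def using sub B'(4) by (simp add: subspace_sum subspace_scale)
  have "linear_on_subspace V T"
    unfolding linear_on_subspace_def T_def
    by (simp add: B'(4) form_add form_scale scaleR_add_left sum.distrib scaleR_sum_right)
  then obtain h where h: "linear h" "\<And>x. x \<in> V \<Longrightarrow> h x = T x"
    using linear_on_subspace_extend sub by blast
  have coeffs: "c b = d b" if "(\<Sum>b\<in>B. c b *\<^sub>R b) = (\<Sum>b\<in>B. d b *\<^sub>R b)" "b \<in> B" for c d b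
    using independentD[OF B'(2,1) order_refl, of "\<lambda>b. c b - d b" b] that
    by (simp add: scaleR_diff_left sum_subtractf)
  have inj: "inj_on h (span B)"
  proof
    fix x y assume xy: "x \<in> span B" "y \<in> span B" "h x = h y"
    then have "\<And>b. b \<in> B \<Longrightarrow> g x b = g y b"
      using coeffs[of "g x" "g y"] h(2) B'(3) by (simp add: T_def)
    then have "g x z = g y z" if "z \<in> V" for z
      using linear_on_subspace_eqI[OF B form_linear_right form_linear_right] xy B'(3) that
      by blast
    then show "x = y" using form_eqI xy B'(3) by blast
  qed
  have "independent (h ` B)"
    using linear_independent_injective_image[OF h(1) B'(2) inj] .
  moreover have "card (h ` B) = card B"
    by (rule card_image) (meson inj inj_on_subset span_superset)
  moreover have "h ` B \<subseteq> span B"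
    using h(2) T_in B'(3,4) by auto
  ultimately have "span (h ` B) = V"
    using span_eq_if_independent_card[OF B'(1)] B'(3) by blast
  then have "h ` V = V"
    using linear_span_image[OF h(1), of B] B'(3) by simp
  moreover have "(\<Sum>b\<in>B. \<phi> b *\<^sub>R b) \<in> V"
    using sub B'(4) by (simp add: subspace_sum subspace_scale)
  ultimately obtain v where v: "v \<in> V" "h v = (\<Sum>b\<in>B. \<phi> b *\<^sub>R b)"
    by (metis imageE)
  then have "T v = (\<Sum>b\<in>B. \<phi> b *\<^sub>R b)" using h(2) by simp
  then have "g v b = \<phi> b" if "b \<in> B" for b
    using coeffs[of "g v" \<phi> b] that by (simp add: T_def)
  with v(1) that show thesis by blast
qed

lemma form_representation:
  assumes "linear_on_subspace V \<phi>"
  obtains v where "v \<in> V" "\<And>x. x \<in> V \<Longrightarrow> g v x = \<phi> x"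
proof -
  obtain B where B: "finite_basis V B" using finite_basis_exists[OF fin_dim] .
  obtain v where v: "v \<in> V" "\<And>b. b \<in> B \<Longrightarrow> g v b = \<phi> b"
    using form_representation_basis[OF B] by blast
  then have "\<And>x. x \<in> V \<Longrightarrow> g v x = \<phi> x"
    using linear_on_subspace_eqI[OF B form_linear_right assms] by blast
  with v that show thesis by blast
qed

text \<open>With the projection \<open>\<pi>\<close> onto \<open>V1\<close> along \<open>V2\<close>,
  the functional \<open>g v\<close> is the sum of its composites with \<open>\<pi>\<close> and with
  the complementary projection; \<open>a\<close> represents the former. The summands need not be
  orthogonal, so \<open>a\<close> and \<open>b\<close> lie in annihilators rather than in
  \<open>V1\<close> and \<open>V2\<close>.\<close>

lemma dual_decomposition:
  assumes V: "is_direct_sum V V1 V2" and v: "v \<in> V"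
  obtains a b where "a \<in> V" "b \<in> V" "v = a + b"
    "\<And>x. x \<in> V2 \<Longrightarrow> g a x = 0" "\<And>x. x \<in> V1 \<Longrightarrow> g b x = 0"
proof -
  obtain \<pi> where \<pi>: "linear_on_subspace V \<pi>" "\<And>x. x \<in> V \<Longrightarrow> \<pi> x \<in> V1"
    "\<And>x. x \<in> V1 \<Longrightarrow> \<pi> x = x" "\<And>x. x \<in> V2 \<Longrightarrow> \<pi> x = 0"
    using is_direct_sum_projection[OF V] by metis
  note V12 = is_direct_sum_subset[OF V]
  have "linear_on_subspace V (\<lambda>x. g v (\<pi> x))"
    using \<pi>(1,2) V12 v unfolding linear_on_subspace_def
    by (simp add: form_add form_scale subset_iff)
  then obtain a where a: "a \<in> V" "\<And>x. x \<in> V \<Longrightarrow> g a x = g v (\<pi> x)"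
    using form_representation by blast
  show thesis
  proof
    show "a \<in> V" "v - a \<in> V" using a v sub by (simp_all add: subspace_diff)
    show "v = a + (v - a)" by simp
    show "g a x = 0" if "x \<in> V2" for x
      using that a \<pi>(4) V12 v by (simp add: form_zero subset_iff)
    show "g (v - a) x = 0" if "x \<in> V1" for x
      using that a \<pi>(3) V12 v by (simp add: form_diff subset_iff)
  qed
qed

lemma subspace_orthogonal: "u \<in> V \<Longrightarrow> subspace {v \<in> V. g u v = 0}"
  using sub by (auto simp: subspace_def form_add form_scale form_zero)

lemma non_null_direct_sum:
  assumes u: "u \<in> V" "g u u \<noteq> 0"
  shows "is_direct_sum V (span {u}) {v \<in> V. g u v = 0}"
proof (rule is_direct_sumI)
  show "subspace (span {u})" "subspace {v \<in> V. g u v = 0}"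
    using subspace_orthogonal[OF u(1)] by simp_all
  show "x = 0" if "x \<in> span {u}" "x \<in> {v \<in> V. g u v = 0}" for x
    using that u by (auto simp: span_singleton form_scale)
  have "span {u} \<subseteq> V" using u(1) sub by (simp add: span_minimal)
  then show "a + b \<in> V" if "a \<in> span {u}" "b \<in> {v \<in> V. g u v = 0}" for a b
    using that sub by (simp add: subspace_add subset_iff)
  fix v assume v: "v \<in> V"
  \<comment> \<open>The orthogonal projection of \<open>v\<close> to the line of \<open>u\<close>;
    the division is legitimate because \<open>u\<close> is non-null.\<close>
  let ?x = "(g u v / g u u) *\<^sub>R u"
  show "\<exists>a\<in>span {u}. \<exists>b\<in>{v \<in> V. g u v = 0}. v = a + b"
  proof (intro bexI)
    show "v = ?x + (v - ?x)" by simp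
    show "?x \<in> span {u}" by (simp add: span_base span_scale)
    show "v - ?x \<in> {v \<in> V. g u v = 0}"
      using u v sub by (simp add: form_diff form_scale subspace_diff subspace_scale)
  qed
qed

lemma orthogonal_nontrivial:
  assumes u: "u \<in> V" "g u u \<noteq> 0" and "V \<noteq> span {u}"
  shows "{v \<in> V. g u v = 0} \<noteq> {0}"
proof
  assume "{v \<in> V. g u v = 0} = {0}"
  then have "V = {x + y | x y. x \<in> span {u} \<and> y \<in> {0}}"
    using non_null_direct_sum[OF u] by (simp add: is_direct_sum_def)
  then show False using assms(3) by simp
qed

end

section \<open>Curvature tensors and models\<close>

lemma alg_curv_tensor_subset:
  "alg_curv_tensor V A \<Longrightarrow> U \<subseteq> V \<Longrightarrow> alg_curv_tensor U A"
  unfolding alg_curv_tensor_def multilinear4_on_def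
  by (meson linear_on_subspace_subset subset_iff)

locale curvature_space =
  fixes V :: "'v::real_vector set" and A :: "'v form4"
  assumes fin_dim_curv: "fin_dim_subspace V" and curv: "alg_curv_tensor V A"
begin

lemma subspace_curv: "subspace V"
  using fin_dim_curv by (rule fin_dim_subspaceD)

lemma curv_skew: "x \<in> V \<Longrightarrow> y \<in> V \<Longrightarrow> z \<in> V \<Longrightarrow> w \<in> V \<Longrightarrow> A x y z w = - A y x z w"
  using curv unfolding alg_curv_tensor_def by blast

lemma curv_pair: "x \<in> V \<Longrightarrow> y \<in> V \<Longrightarrow> z \<in> V \<Longrightarrow> w \<in> V \<Longrightarrow> A x y z w = A z w x y"
  using curv unfolding alg_curv_tensor_def by blast

lemma curv_bianchi:
  "x \<in> V \<Longrightarrow> y \<in> V \<Longrightarrow> z \<in> V \<Longrightarrow> w \<in> V \<Longrightarrow> A x y z w + A y z x w + A z x y w = 0"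
  using curv unfolding alg_curv_tensor_def by blast

lemma curv_skew': "x \<in> V \<Longrightarrow> y \<in> V \<Longrightarrow> z \<in> V \<Longrightarrow> w \<in> V \<Longrightarrow> A x y z w = - A x y w z"
  using curv_pair curv_skew by metis

lemma curv_linear:
  assumes "x \<in> V" "y \<in> V" "z \<in> V"
  shows "linear_on_subspace V (\<lambda>u. A u x y z)" "linear_on_subspace V (\<lambda>u. A x u y z)"
    "linear_on_subspace V (\<lambda>u. A x y u z)" "linear_on_subspace V (\<lambda>u. A x y z u)"
  using curv assms by (auto simp: alg_curv_tensor_def multilinear4_on_def)

lemma curv_add:
  assumes "x \<in> V" "y \<in> V" "z \<in> V" "u \<in> V" "v \<in> V"
  shows "A (u + v) x y z = A u x y z + A v x y z" "A x (u + v) y z = A x u y z + A x v y z"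
    "A x y (u + v) z = A x y u z + A x y v z" "A x y z (u + v) = A x y z u + A x y z v"
  using curv_linear[OF assms(1-3)] assms(4,5) by (simp_all add: linear_on_subspace_def)

lemma curv_scale:
  assumes "x \<in> V" "y \<in> V" "z \<in> V" "u \<in> V"
  shows "A (c *\<^sub>R u) x y z = c * A u x y z"
  using curv_linear(1)[OF assms(1-3)] assms(4) by (simp add: linear_on_subspace_def)

lemma curv_zero:
  assumes "x \<in> V" "y \<in> V" "z \<in> V"
  shows "A 0 x y z = 0" "A x 0 y z = 0" "A x y 0 z = 0" "A x y z 0 = 0"
  using curv_linear[OF assms] linear_on_subspace_0[OF subspace_curv] by fast+

lemma curv_kernel:
  assumes "k \<in> V" and "\<And>x y z. x \<in> V \<Longrightarrow> y \<in> V \<Longrightarrow> z \<in> V \<Longrightarrow> A k x y z = 0"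
    and "x \<in> V" "y \<in> V" "z \<in> V"
  shows "A x k y z = 0" "A x y k z = 0" "A x y z k = 0"
proof -
  show *: "A x k y z = 0" using assms curv_skew[of x k y z] by simp
  show "A x y k z = 0" using assms curv_pair[of x y k z] by simp
  show "A x y z k = 0" using assms * curv_pair[of x y z k] curv_skew[of z k x y] by simp
qed

text \<open>The components with two arguments in each summand vanish by the Bianchi identity.\<close>

lemma curv_splits:
  assumes V: "is_direct_sum V V1 V2"
    and 0: "\<And>x y z w. x \<in> V1 \<Longrightarrow> y \<in> V2 \<Longrightarrow> z \<in> V \<Longrightarrow> w \<in> V \<Longrightarrow> A x y z w = 0"
  shows "tensor_splits V1 V2 A A A"
  unfolding tensor_splits_def
proof (intro ballI)
  fix x1 y1 z1 w1 x2 y2 z2 w2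
  assume 1: "x1 \<in> V1" "y1 \<in> V1" "z1 \<in> V1" "w1 \<in> V1"
    and 2: "x2 \<in> V2" "y2 \<in> V2" "z2 \<in> V2" "w2 \<in> V2"
  have in1 [simp]: "x \<in> V" if "x \<in> V1" for x using that is_direct_sum_subset[OF V] by blast
  have in2 [simp]: "x \<in> V" if "x \<in> V2" for x using that is_direct_sum_subset[OF V] by blast
  have [simp]: "x + y \<in> V" if "x \<in> V" "y \<in> V" for x y
    using that subspace_curv by (simp add: subspace_add)
  have 12: "A x y z w = 0" "A y x z w = 0" "A z w x y = 0" "A z w y x = 0"
    if "x \<in> V1" "y \<in> V2" "z \<in> V" "w \<in> V" for x y z w
    using that 0[of x y z w] curv_skew[of x y z w] curv_skew[of x y w z] curv_pair[of x y z w]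
      curv_pair[of y x z w] by auto
  have 22: "A x y z w = 0" "A z w x y = 0"
    if "x \<in> V1" "y \<in> V1" "z \<in> V2" "w \<in> V2" for x y z w
    using that curv_bianchi[of x y z w] 12(1)[of y z x w] 12(2)[of x z y w] curv_pair[of x y z w]
    by auto
  show "A (x1 + x2) (y1 + y2) (z1 + z2) (w1 + w2) = A x1 y1 z1 w1 + A x2 y2 z2 w2"
    using 1 2 by (simp add: curv_add 12 22)
qed

text \<open>Writing the first two arguments as \<open>x + 0\<close> and \<open>0 + y\<close> puts a
  zero into each of the summand tensors, so both terms vanish by multilinearity.\<close>

lemma curv_splitsD:
  assumes V: "is_direct_sum V V1 V2" and "alg_curv_tensor V1 A1" "alg_curv_tensor V2 A2"
    and s: "tensor_splits V1 V2 A A1 A2"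
    and x: "x \<in> V1" and y: "y \<in> V2" and z: "z \<in> V" and w: "w \<in> V"
  shows "A x y z w = 0"
proof -
  have V12: "subspace V1" "subspace V2" using V by (simp_all add: is_direct_sum_def)
  interpret V1: curvature_space V1 A1
    by (rule curvature_space.intro[OF fin_dim_subspace_mono[OF fin_dim_curv V12(1)
      is_direct_sum_subset(1)[OF V]] assms(2)])
  interpret V2: curvature_space V2 A2
    by (rule curvature_space.intro[OF fin_dim_subspace_mono[OF fin_dim_curv V12(2)
      is_direct_sum_subset(2)[OF V]] assms(3)])
  have 00: "0 \<in> V1" "0 \<in> V2" using V12 by (auto simp: subspace_0)
  obtain z1 z2 w1 w2 where zw: "z1 \<in> V1" "z2 \<in> V2" "z = z1 + z2" "w1 \<in> V1" "w2 \<in> V2" "w = w1 + w2"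
    using is_direct_sum_decompose[OF V z] is_direct_sum_decompose[OF V w] by metis
  have "A (x + 0) (0 + y) (z1 + z2) (w1 + w2) = A1 x 0 z1 w1 + A2 0 y z2 w2"
    using s x y zw 00 unfolding tensor_splits_def by blast
  then show ?thesis using x y zw V1.curv_zero V2.curv_zero by simp
qed

text \<open>Eliminates the tensors of the summands: restrictions of \<open>A\<close> serve as
  \<open>A1\<close> and \<open>A2\<close>. Only the first two slots need to be tested on mixed
  vectors, as the symmetries control all the others.\<close>

lemma indecomposable_curv_iff:
  "indecomposable_curv V A \<longleftrightarrow>
    \<not> (\<exists>V1 V2. is_direct_sum V V1 V2 \<and> V1 \<noteq> {0} \<and> V2 \<noteq> {0} \<and>
        (\<forall>x\<in>V1. \<forall>y\<in>V2. \<forall>z\<in>V. \<forall>w\<in>V. A x y z w = 0))"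
proof -
  have dim: "dim U \<ge> 1 \<longleftrightarrow> U \<noteq> {0}" if "subspace U" "U \<subseteq> V" for U
    using dim_ge_1_iff fin_dim_subspace_mono[OF fin_dim_curv that] by blast
  have "(\<exists>A1 A2. is_direct_sum V V1 V2 \<and> dim V1 \<ge> 1 \<and> dim V2 \<ge> 1 \<and>
          alg_curv_tensor V1 A1 \<and> alg_curv_tensor V2 A2 \<and> tensor_splits V1 V2 A A1 A2) \<longleftrightarrow>
        is_direct_sum V V1 V2 \<and> V1 \<noteq> {0} \<and> V2 \<noteq> {0} \<and>
          (\<forall>x\<in>V1. \<forall>y\<in>V2. \<forall>z\<in>V. \<forall>w\<in>V. A x y z w = 0)" (is "?L \<longleftrightarrow> ?R") for V1 V2
  proof (cases "is_direct_sum V V1 V2")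
    case True
    then have "subspace V1" "subspace V2" by (simp_all add: is_direct_sum_def)
    then have d: "dim V1 \<ge> 1 \<longleftrightarrow> V1 \<noteq> {0}" "dim V2 \<ge> 1 \<longleftrightarrow> V2 \<noteq> {0}"
      using dim is_direct_sum_subset[OF True] by blast+
    have "alg_curv_tensor V1 A" "alg_curv_tensor V2 A"
      using alg_curv_tensor_subset[OF curv] is_direct_sum_subset[OF True] by auto
    then have "?R \<Longrightarrow> ?L" using d curv_splits[OF True] by blast
    moreover have "?L \<Longrightarrow> ?R" unfolding d using curv_splitsD by blast
    ultimately show ?thesis by blast
  qed blast
  then show ?thesis unfolding indecomposable_curv_def by simp
qed

lemma indecomposable_curvD:
  assumes ind: "indecomposable_curv V A" and V: "is_direct_sum V V1 V2" "V1 \<noteq> {0}" "V2 \<noteq> {0}"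
    and 0: "\<And>x y z w. x \<in> V1 \<Longrightarrow> y \<in> V2 \<Longrightarrow> z \<in> V \<Longrightarrow> w \<in> V \<Longrightarrow> A x y z w = 0"
  shows False
  using ind
proof (rule indecomposable_curv_iff[THEN iffD1, THEN notE])
  show "\<exists>V1 V2. is_direct_sum V V1 V2 \<and> V1 \<noteq> {0} \<and> V2 \<noteq> {0} \<and>
      (\<forall>x\<in>V1. \<forall>y\<in>V2. \<forall>z\<in>V. \<forall>w\<in>V. A x y z w = 0)"
    by (intro exI[of _ V1] exI[of _ V2] conjI ballI V 0)
qed

end

locale model =
  fixes M :: "'v::real_vector curv_model"
  assumes is_model: "is_model M"
begin

abbreviation "V \<equiv> space_of M"
abbreviation "g \<equiv> form_of M"
abbreviation "A \<equiv> curv_of M"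

end

sublocale model \<subseteq> scalar_product_space "space_of M" "form_of M"
  using is_model by unfold_locales (auto simp: is_model_def)

sublocale model \<subseteq> curvature_space "space_of M" "curv_of M"
  using is_model by unfold_locales (auto simp: is_model_def)

context model
begin

text \<open>A vector of \<open>V1\<close> orthogonal to \<open>V1\<close> is also orthogonal to
  \<open>V2\<close>, hence to \<open>V\<close>, and non-degeneracy on \<open>V\<close>
  applies.\<close>

lemma inner_product_on_orthogonal_summand:
  assumes V: "is_direct_sum V V1 V2" and 0: "\<And>x y. x \<in> V1 \<Longrightarrow> y \<in> V2 \<Longrightarrow> g x y = 0"
  shows "inner_product_on V1 g"
proof -
  have V1: "V1 \<subseteq> V" using is_direct_sum_subset[OF V] by blast
  have "x = 0" if x: "x \<in> V1" "\<And>y. y \<in> V1 \<Longrightarrow> g x y = 0" for x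
  proof (rule form_nondegenerate)
    show "x \<in> V" using x V1 by blast
    fix y assume "y \<in> V"
    with V obtain y1 y2 where y: "y1 \<in> V1" "y2 \<in> V2" "y = y1 + y2"
      by (rule is_direct_sum_decompose)
    then show "g x y = 0"
      using x 0 is_direct_sum_subset[OF V] by (simp add: form_add subset_iff)
  qed
  then show ?thesis
    unfolding inner_product_on_def
    using V1 form_commute form_linear_left form_linear_right
    by (meson linear_on_subspace_subset subset_iff)
qed

text \<open>Reduces a splitting to its two subspaces. Conversely, restricting \<open>g\<close> and
  \<open>A\<close> turns such a pair of subspaces into models, the restricted forms being
  non-degenerate by orthogonality.\<close>

lemma indecomposable_model_iff:
  "indecomposable_model M \<longleftrightarrow>
    \<not> (\<exists>V1 V2. is_direct_sum V V1 V2 \<and> V1 \<noteq> {0} \<and> V2 \<noteq> {0} \<and>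
        (\<forall>x\<in>V1. \<forall>y\<in>V2. g x y = 0) \<and>
        (\<forall>x\<in>V1. \<forall>y\<in>V2. \<forall>z\<in>V. \<forall>w\<in>V. A x y z w = 0))" (is "_ \<longleftrightarrow> \<not> ?R")
proof -
  let ?L = "\<exists>M1 M2. is_model M1 \<and> is_model M2 \<and> dim (space_of M1) \<ge> 1 \<and> dim (space_of M2) \<ge> 1 \<and>
    model_splits M M1 M2"
  have ?R if ?L
  proof -
    obtain M1 M2 where M: "is_model M1" "is_model M2" "dim (space_of M1) \<ge> 1"
      "dim (space_of M2) \<ge> 1" "model_splits M M1 M2"
      using \<open>?L\<close> by blast
    interpret M1: model M1 by (rule model.intro[OF M(1)])
    interpret M2: model M2 by (rule model.intro[OF M(2)])
    have V: "is_direct_sum V M1.V M2.V" using M by (simp add: model_splits_def)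
    have "M1.V \<noteq> {0}" "M2.V \<noteq> {0}"
      using M dim_ge_1_iff[OF M1.fin_dim] dim_ge_1_iff[OF M2.fin_dim] by auto
    moreover have "A x y z w = 0" if "x \<in> M1.V" "y \<in> M2.V" "z \<in> V" "w \<in> V" for x y z w
      using that curv_splitsD[OF V M1.curv M2.curv] M(5) by (simp add: model_splits_def)
    moreover have "g x y = 0" if xy: "x \<in> M1.V" "y \<in> M2.V" for x y
    proof -
      have "g (x + 0) (0 + y) = M1.g x 0 + M2.g 0 y"
        using M(5) xy subspace_0[OF M1.sub] subspace_0[OF M2.sub] unfolding model_splits_def by blast
      then show ?thesis using xy by (simp add: M1.form_zero M2.form_zero)
    qed
    ultimately show ?R using V by blast
  qed
  moreover have ?L if ?R
  proof -
    obtain V1 V2 where V: "is_direct_sum V V1 V2" "V1 \<noteq> {0}" "V2 \<noteq> {0}"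
      "\<forall>x\<in>V1. \<forall>y\<in>V2. g x y = 0" "\<forall>x\<in>V1. \<forall>y\<in>V2. \<forall>z\<in>V. \<forall>w\<in>V. A x y z w = 0"
      using \<open>?R\<close> by blast
    have sub12: "subspace V1" "subspace V2" using V(1) by (simp_all add: is_direct_sum_def)
    have le: "V1 \<subseteq> V" "V2 \<subseteq> V" using is_direct_sum_subset[OF V(1)] by auto
    have fd: "fin_dim_subspace V1" "fin_dim_subspace V2"
      using fin_dim_subspace_mono[OF fin_dim] sub12 le by auto
    have 0: "g x y = 0" "g y x = 0" if "x \<in> V1" "y \<in> V2" for x y
      using that V(4) form_commute[of x y] le by (auto simp: subset_iff)
    have ip: "inner_product_on V1 g" "inner_product_on V2 g"
      using inner_product_on_orthogonal_summand[OF V(1)]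
        inner_product_on_orthogonal_summand[OF is_direct_sum_commute[OF V(1)]] 0 by auto
    have "model_splits M \<lparr>space_of = V1, form_of = g, curv_of = A\<rparr>
        \<lparr>space_of = V2, form_of = g, curv_of = A\<rparr>"
      using V(1) curv_splits[OF V(1)] V(5) le sub
      by (auto simp: model_splits_def form_add 0 subset_iff subspace_add)
    moreover have "is_model \<lparr>space_of = V1, form_of = g, curv_of = A\<rparr>"
      "is_model \<lparr>space_of = V2, form_of = g, curv_of = A\<rparr>"
      using fd ip alg_curv_tensor_subset[OF curv] le by (auto simp: is_model_def)
    ultimately show ?L
      using dim_ge_1_iff fd V(2,3) by (metis curv_model.select_convs(1))
  qed
  ultimately have "?L = ?R" by (rule iffI)
  then show ?thesis unfolding indecomposable_model_def by (rule arg_cong)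
qed

lemma indecomposable_modelD:
  assumes ind: "indecomposable_model M" and V: "is_direct_sum V V1 V2" "V1 \<noteq> {0}" "V2 \<noteq> {0}"
    and orth: "\<And>x y. x \<in> V1 \<Longrightarrow> y \<in> V2 \<Longrightarrow> g x y = 0"
    and 0: "\<And>x y z w. x \<in> V1 \<Longrightarrow> y \<in> V2 \<Longrightarrow> z \<in> V \<Longrightarrow> w \<in> V \<Longrightarrow> A x y z w = 0"
  shows False
  using ind
proof (rule indecomposable_model_iff[THEN iffD1, THEN notE])
  show "\<exists>V1 V2. is_direct_sum V V1 V2 \<and> V1 \<noteq> {0} \<and> V2 \<noteq> {0} \<and>
      (\<forall>x\<in>V1. \<forall>y\<in>V2. g x y = 0) \<and>
      (\<forall>x\<in>V1. \<forall>y\<in>V2. \<forall>z\<in>V. \<forall>w\<in>V. A x y z w = 0)"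
    by (intro exI[of _ V1] exI[of _ V2] conjI ballI V orth 0)
qed

section \<open>Curvature operators and the two nilpotency conditions\<close>

lemma curv_operator:
  assumes "x \<in> V" "y \<in> V" "z \<in> V"
  shows "curv_operator M x y z \<in> V" "\<And>w. w \<in> V \<Longrightarrow> g (curv_operator M x y z) w = A x y z w"
proof -
  obtain v where v: "v \<in> V" "\<And>w. w \<in> V \<Longrightarrow> g v w = A x y z w"
    using form_representation[OF curv_linear(4)[OF assms]] by blast
  have "\<exists>!v. v \<in> V \<and> (\<forall>w\<in>V. g v w = A x y z w)"
  proof
    show "v \<in> V \<and> (\<forall>w\<in>V. g v w = A x y z w)" using v by blast
    show "\<And>u. u \<in> V \<and> (\<forall>w\<in>V. g u w = A x y z w) \<Longrightarrow> u = v"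
      using form_eqI v by metis
  qed
  from theI'[OF this] show "curv_operator M x y z \<in> V"
    "\<And>w. w \<in> V \<Longrightarrow> g (curv_operator M x y z) w = A x y z w"
    unfolding curv_operator_def by blast+
qed

lemma form_curv_operator_right:
  assumes "x \<in> V" "y \<in> V" "z \<in> V" "w \<in> V"
  shows "g w (curv_operator M x y z) = A x y z w"
  using curv_operator[of x y z] assms form_commute by metis

text \<open>Skewness in the last two slots moves the outer operator across the form. Since
  \<open>A a b c u\<close> is the pairing of the curvature vector of \<open>a\<close>,
  \<open>b\<close>, \<open>c\<close> with \<open>u\<close>, the right-hand side says that any two
  values of curvature operators are orthogonal.\<close>

lemma skew_nilpotent_iff:
  "two_step_skew_curvature_nilpotent M \<longleftrightarrow>
    (\<forall>a\<in>V. \<forall>b\<in>V. \<forall>c\<in>V. \<forall>x\<in>V. \<forall>y\<in>V. \<forall>z\<in>V.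
      A a b c (curv_operator M x y z) = 0)"
proof -
  have "curv_operator M a b (curv_operator M x y z) = 0 \<longleftrightarrow>
      (\<forall>c\<in>V. A a b c (curv_operator M x y z) = 0)"
    if "a \<in> V" "b \<in> V" "x \<in> V" "y \<in> V" "z \<in> V" for a b x y z
  proof -
    let ?v = "curv_operator M a b (curv_operator M x y z)"
    have u: "curv_operator M x y z \<in> V" "?v \<in> V" using that by (simp_all add: curv_operator(1))
    have "?v = 0 \<longleftrightarrow> (\<forall>c\<in>V. g ?v c = 0)"
      using form_nondegenerate[of ?v] u(2) by (auto simp: form_zero)
    also have "\<dots> \<longleftrightarrow> (\<forall>c\<in>V. A a b c (curv_operator M x y z) = 0)"
      using curv_operator(2)[OF that(1,2) u(1)] curv_skew'[OF that(1,2) _ u(1)] by auto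
    finally show ?thesis .
  qed
  then show ?thesis unfolding two_step_skew_curvature_nilpotent_def by auto
qed

text \<open>Polarising \<open>J\<close> and using the Bianchi identity expresses \<open>-3 \<A>(x,y)z\<close> through Jacobi operators;
  hence both nilpotency conditions say that the range of the curvature operators is totally
  isotropic.\<close>

lemma jacobi_nilpotent_iff_skew_nilpotent:
  "two_step_jacobi_nilpotent M \<longleftrightarrow> two_step_skew_curvature_nilpotent M"
proof
  assume skew: "two_step_skew_curvature_nilpotent M"
  have "curv_operator M (curv_operator M v y y) x x = 0"
    if xyv: "x \<in> V" "y \<in> V" "v \<in> V" for x y v
  proof (rule form_nondegenerate)
    have u: "curv_operator M v y y \<in> V" using xyv by (simp add: curv_operator(1))
    then show "curv_operator M (curv_operator M v y y) x x \<in> V" using xyv by (simp add: curv_operator(1))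
    fix w assume w: "w \<in> V"
    have "A (curv_operator M v y y) x x w = - A x w x (curv_operator M v y y)"
      using curv_pair[OF u _ _ w] curv_skew'[OF _ w u] xyv by simp
    also have "\<dots> = 0" using skew xyv w by (simp add: skew_nilpotent_iff)
    finally show "g (curv_operator M (curv_operator M v y y) x x) w = 0"
      using curv_operator(2)[OF u] xyv w by simp
  qed
  then show "two_step_jacobi_nilpotent M"
    by (simp add: two_step_jacobi_nilpotent_def jacobi_operator_def)
next
  assume jac: "two_step_jacobi_nilpotent M"
  have iso1: "A x w x (curv_operator M v y y) = 0"
    if xyv: "x \<in> V" "y \<in> V" "v \<in> V" "w \<in> V" for x y v w
  proof -
    have u: "curv_operator M v y y \<in> V" using xyv by (simp add: curv_operator(1))
    have "A (curv_operator M v y y) x x w = 0"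
      using jac xyv curv_operator(2)[OF u, of x x w]
      by (simp add: two_step_jacobi_nilpotent_def jacobi_operator_def form_zero)
    then show ?thesis
      using curv_pair[OF u xyv(1,1,4)] curv_skew'[OF xyv(1,4) u xyv(1)] by simp
  qed
  have range: "A a b c u = 0"
    if u: "u \<in> V" and J: "\<And>x w. x \<in> V \<Longrightarrow> w \<in> V \<Longrightarrow> A x w x u = 0"
      and abc: "a \<in> V" "b \<in> V" "c \<in> V" for a b c u
  proof -
    have pol: "A x w z u + A z w x u = 0" if "x \<in> V" "z \<in> V" "w \<in> V" for x z w
      using that J[of "x + z" w] J[of x w] J[of z w] u sub by (simp add: curv_add subspace_add)
    \<comment> \<open>Polarisation and skewness make \<open>A a b c u\<close> invariant under cyclic
      permutation of \<open>a\<close>, \<open>b\<close>, \<open>c\<close>, so the Bianchi identity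
      reads \<open>3 * A a b c u = 0\<close>.\<close>
    show ?thesis
      using pol[of a c b] pol[of b c a] curv_bianchi[OF abc u] curv_skew[OF abc(1,2,3) u]
        curv_skew[OF abc(2,3,1) u] curv_skew[OF abc(3,1,2) u] abc by simp
  qed
  have "A a b c (curv_operator M v y y) = 0"
    if "a \<in> V" "b \<in> V" "c \<in> V" "v \<in> V" "y \<in> V" for a b c v y
    using range[OF curv_operator(1)] iso1 that by simp
  \<comment> \<open>The preceding equation is an orthogonality between a general curvature vector
    and a Jacobi vector. Reading it from the other side turns it into a condition on the general
    curvature vector, to which \<open>range\<close> can then be applied a second time.\<close>
  then have "A v y y (curv_operator M a b c) = 0"
    if "a \<in> V" "b \<in> V" "c \<in> V" "v \<in> V" "y \<in> V" for a b c v y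
    using that by (metis curv_operator(1,2) form_curv_operator_right)
  then have iso2: "A y w y (curv_operator M a b c) = 0"
    if "a \<in> V" "b \<in> V" "c \<in> V" "w \<in> V" "y \<in> V" for a b c w y
    using that curv_skew[of y w y "curv_operator M a b c"] curv_operator(1)[of a b c] by simp
  show "two_step_skew_curvature_nilpotent M"
    unfolding skew_nilpotent_iff
    by (intro ballI, rule range[OF curv_operator(1)]) (simp_all add: iso2)
qed

section \<open>The kernel of an indecomposable nilpotent model\<close>

definition "K = {k \<in> V. \<forall>x\<in>V. \<forall>y\<in>V. \<forall>z\<in>V. A k x y z = 0}"

lemma K_in: "k \<in> K \<Longrightarrow> k \<in> V"
  by (simp add: K_def)

lemma curv_K:
  assumes "k \<in> K" "x \<in> V" "y \<in> V" "z \<in> V"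
  shows "A k x y z = 0" "A x k y z = 0" "A x y k z = 0" "A x y z k = 0"
  using assms curv_kernel[of k x y z] by (simp_all add: K_def)

lemma subspace_K: "subspace K"
  using sub unfolding subspace_def by (auto simp: K_def curv_zero curv_add curv_scale)

text \<open>This is the descent of \<open>A\<close> to the quotient of \<open>V\<close> by
  \<open>K\<close>; it allows \<open>A\<close> to be evaluated on the components in a complement of
  \<open>K\<close>.\<close>

lemma curv_diff_K:
  assumes "x \<in> V" "y \<in> V" "z \<in> V" "w \<in> V" "x' \<in> V" "y' \<in> V" "z' \<in> V" "w' \<in> V"
    and "x - x' \<in> K" "y - y' \<in> K" "z - z' \<in> K" "w - w' \<in> K"
  shows "A x y z w = A x' y' z' w'"
proof -
  have "A x y z w = A (x' + (x - x')) (y' + (y - y')) (z' + (z - z')) (w' + (w - w'))" by simp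
  also have "\<dots> = A x' (y' + (y - y')) (z' + (z - z')) (w' + (w - w'))"
    by (subst curv_add(1)) (use assms K_in in \<open>simp_all add: curv_K\<close>)
  also have "\<dots> = A x' y' (z' + (z - z')) (w' + (w - w'))"
    by (subst curv_add(2)) (use assms K_in in \<open>simp_all add: curv_K\<close>)
  also have "\<dots> = A x' y' z' (w' + (w - w'))"
    by (subst curv_add(3)) (use assms K_in in \<open>simp_all add: curv_K\<close>)
  also have "\<dots> = A x' y' z' w'"
    by (subst curv_add(4)) (use assms K_in in \<open>simp_all add: curv_K\<close>)
  finally show ?thesis .
qed

lemma kernel_null:
  assumes ind: "indecomposable_model M" and dim: "dim V \<ge> 3" and u: "u \<in> K"
  shows "g u u = 0"
proof (rule ccontr)
  assume u0: "g u u \<noteq> 0"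
  have uV: "u \<in> V" using u by (rule K_in)
  have "A x y z w = 0" if "x \<in> span {u}" "y \<in> {v \<in> V. g u v = 0}" "z \<in> V" "w \<in> V" for x y z w
    using that u uV by (auto simp: span_singleton curv_scale curv_K)
  moreover have "g x y = 0" if "x \<in> span {u}" "y \<in> {v \<in> V. g u v = 0}" for x y
    using that uV by (auto simp: span_singleton form_scale)
  moreover have "u \<noteq> 0" using u0 uV by (auto simp: form_zero)
  then have "span {u} \<noteq> {0}" using span_base[of u "{u}"] by auto
  \<comment> \<open>The orthogonal complement must be a nonzero summand, so the line of
    \<open>u\<close> may not be all of \<open>V\<close>; here the dimension bound enters.\<close>
  moreover have "V \<noteq> span {u}"
  proof
    assume "V = span {u}"
    then have "dim V \<le> card {u}" by (metis dim_le_card finite.intros order_refl)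
    with dim show False by simp
  qed
  ultimately show False
    using indecomposable_modelD[OF ind non_null_direct_sum[OF uV u0]]
      orthogonal_nontrivial[OF uV u0] by blast
qed

lemma kernel_isotropic:
  assumes ind: "indecomposable_model M" and dim: "dim V \<ge> 3" and k: "k \<in> K" "l \<in> K"
  shows "g k l = 0"
proof -
  have "g (k + l) (k + l) = 0"
    using kernel_null[OF ind dim] k subspace_K by (simp add: subspace_add)
  moreover have "k \<in> V" "l \<in> V" using k K_in by auto
  ultimately show ?thesis
    using kernel_null[OF ind dim] k form_commute[of l k] sub by (simp add: form_add subspace_add)
qed

text \<open>Nilpotency puts every curvature vector into \<open>K\<close>. A vector \<open>x\<close>
  orthogonal to \<open>K\<close> is thus orthogonal to all curvature vectors, and pair symmetry
  moves \<open>x\<close> from the last slot of \<open>A\<close> to the first.\<close>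

lemma orthogonal_kernel:
  assumes skew: "two_step_skew_curvature_nilpotent M" and x: "x \<in> V"
    and 0: "\<And>k. k \<in> K \<Longrightarrow> g x k = 0"
  shows "x \<in> K"
  unfolding K_def
proof (intro CollectI conjI ballI)
  fix y z w assume yzw: "y \<in> V" "z \<in> V" "w \<in> V"
  let ?u = "curv_operator M z w y"
  have u: "?u \<in> V" using yzw by (simp add: curv_operator(1))
  have "A ?u a b c = 0" if "a \<in> V" "b \<in> V" "c \<in> V" for a b c
  proof -
    have "A ?u a b c = A b c ?u a" using that u by (simp add: curv_pair)
    also have "\<dots> = - A b c a ?u" using that u curv_skew' by blast
    also have "\<dots> = 0" using skew that yzw by (simp add: skew_nilpotent_iff)
    finally show ?thesis .
  qed
  then have "?u \<in> K" using u by (simp add: K_def)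
  then have "A z w y x = 0" using 0[of ?u] form_curv_operator_right[OF yzw(2,3,1) x] by simp
  then show "A x y z w = 0"
    using curv_pair[OF x yzw] curv_skew'[OF yzw(2,3) x yzw(1)] by simp
qed (rule x)

section \<open>Dual families and an isotropic complement of the kernel\<close>

lemma dual_family:
  assumes C: "C \<subseteq> V" "independent C"
  obtains d where "\<And>c. c \<in> C \<Longrightarrow> d c \<in> V"
    "\<And>c c'. c \<in> C \<Longrightarrow> c' \<in> C \<Longrightarrow> g (d c) c' = (if c = c' then 1 else 0)"
proof -
  obtain D where D: "C \<subseteq> D" "D \<subseteq> V" "independent D" "V \<subseteq> span D"
    using maximal_independent_subset_extend[OF C] by metis
  obtain T where T: "finite T" "span T = V" using fin_dim by (auto simp: fin_dim_subspace_def)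
  have "finite D" using independent_span_bound[OF T(1) D(3)] D(2) T(2) by simp
  moreover have "span D = V" using D(2,4) sub by (simp add: span_minimal subset_antisym)
  ultimately have "finite_basis V D" using D(3) by (simp add: finite_basis_def)
  \<comment> \<open>The values 0 on the rest of the basis \<open>D\<close> are an arbitrary choice;
    only the pairings with \<open>C\<close> are kept.\<close>
  then have "\<exists>d\<in>V. \<forall>c'\<in>D. g d c' = (if c = c' then 1 else 0)" for c
    using form_representation_basis[of D "\<lambda>c'. if c = c' then 1 else 0"] by metis
  then obtain d where "\<And>c. d c \<in> V" "\<And>c c'. c' \<in> D \<Longrightarrow> g (d c) c' = (if c = c' then 1 else 0)"
    by metis
  with that[of d] D(1) show thesis by blast
qed

text \<open>A dual family may be changed by vectors of \<open>span C\<close> without disturbing its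
  pairings with the isotropic set \<open>C\<close>, and this freedom suffices to cancel its Gram
  matrix.\<close>

lemma isotropic_dual_family:
  assumes C: "C \<subseteq> V" "independent C" "finite C" and iso: "\<And>c c'. c \<in> C \<Longrightarrow> c' \<in> C \<Longrightarrow> g c c' = 0"
  obtains e where "\<And>c. c \<in> C \<Longrightarrow> e c \<in> V"
    "\<And>c c'. c \<in> C \<Longrightarrow> c' \<in> C \<Longrightarrow> g (e c) c' = (if c = c' then 1 else 0)"
    "\<And>c c'. c \<in> C \<Longrightarrow> c' \<in> C \<Longrightarrow> g (e c) (e c') = 0"
proof -
  obtain d where d: "\<And>c. c \<in> C \<Longrightarrow> d c \<in> V"
    "\<And>c c'. c \<in> C \<Longrightarrow> c' \<in> C \<Longrightarrow> g (d c) c' = (if c = c' then 1 else 0)"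
    using dual_family[OF C(1,2)] by metis
  \<comment> \<open>In the Gram matrix of \<open>d c - s c\<close> the two cross terms each subtract
    half of \<open>g (d c) (d c')\<close>, and the correction vectors pair to zero with each other;
    hence the factor one half.\<close>
  define s where "s c = (\<Sum>b\<in>C. (g (d c) (d b) / 2) *\<^sub>R b)" for c
  have CV: "c \<in> V" if "c \<in> C" for c using that C(1) by blast
  have s: "s c \<in> V" for c
    unfolding s_def using sub CV by (simp add: subspace_sum subspace_scale)
  have s_C: "g (s c) c' = 0" if "c' \<in> C" for c c'
    unfolding s_def using that CV iso by (simp add: form_sum)
  have s_s: "g (s c) (s c') = 0" for c c'
    unfolding s_def[of c'] using CV s s_C by (simp add: form_sum)
  have d_s: "g (d c) (s c') = g (d c) (d c') / 2" if "c \<in> C" "c' \<in> C" for c c'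
  proof -
    have "g (d c) (s c') = (\<Sum>b\<in>C. g (d c') (d b) / 2 * (if c = b then 1 else 0))"
      unfolding s_def using that d CV by (simp add: form_sum)
    also have "\<dots> = (\<Sum>b\<in>C. if c = b then g (d c') (d b) / 2 else 0)"
      by (rule sum.cong) auto
    also have "\<dots> = g (d c') (d c) / 2" using C(3) that by simp
    finally show ?thesis using form_commute[of "d c" "d c'"] d that by simp
  qed
  show thesis
  proof
    show "d c - s c \<in> V" if "c \<in> C" for c using that d s sub by (simp add: subspace_diff)
    show "g (d c - s c) c' = (if c = c' then 1 else 0)" if "c \<in> C" "c' \<in> C" for c c'
      using that d s s_C CV by (simp add: form_diff)
    show "g (d c - s c) (d c' - s c') = 0" if "c \<in> C" "c' \<in> C" for c c'
      using that d s sub d_s[OF that] d_s[OF that(2,1)] s_s form_commute[of "s c" "d c'"]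
        form_commute[of "d c'" "d c"]
      by (simp add: form_diff subspace_diff)
  qed
qed

lemma isomorphic_double_if_skew_nilpotent:
  assumes ind: "indecomposable_model M" and dim: "dim V \<ge> 3"
    and skew: "two_step_skew_curvature_nilpotent M"
  obtains W B where "W \<subseteq> V" "finite_basis W B" "isomorphic_models M (doubled_model W A B)"
proof -
  obtain C where C: "finite_basis K C"
    using fin_dim_subspace_subset[OF fin_dim subspace_K] K_in by blast
  then have C': "finite C" "independent C" "span C = K" "C \<subseteq> K"
    using span_superset by (auto simp: finite_basis_def)
  have CK: "c \<in> K" if "c \<in> C" for c using that C' by blast
  have CV: "c \<in> V" if "c \<in> C" for c using that CK K_in by blast
  have iso: "g k l = 0" if "k \<in> K" "l \<in> K" for k l using kernel_isotropic[OF ind dim] that .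
  obtain e where eV: "\<And>c. c \<in> C \<Longrightarrow> e c \<in> V"
    and eC: "\<And>c c'. c \<in> C \<Longrightarrow> c' \<in> C \<Longrightarrow> g (e c) c' = (if c = c' then 1 else 0)"
    and ee: "\<And>c c'. c \<in> C \<Longrightarrow> c' \<in> C \<Longrightarrow> g (e c) (e c') = 0"
    using isotropic_dual_family[of C] C' CV CK iso by (metis subsetI)
  \<comment> \<open>\<open>P\<close> and \<open>Q\<close> build the vectors with given coordinates
    in the family \<open>e\<close> and in the basis \<open>C\<close> of the kernel. By duality the
    \<open>P\<close>-coordinates are read off by pairing with \<open>C\<close>, the
    \<open>Q\<close>-coordinates by pairing with \<open>e\<close>.\<close>
  define P where "P \<alpha> = (\<Sum>c\<in>C. \<alpha> c *\<^sub>R e c)" for \<alpha>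
  define Q where "Q \<alpha> = (\<Sum>c\<in>C. \<alpha> c *\<^sub>R c)" for \<alpha> :: "'v \<Rightarrow> real"
  have PV: "P \<alpha> \<in> V" for \<alpha> unfolding P_def using sub eV by (simp add: subspace_sum subspace_scale)
  have QK: "Q \<alpha> \<in> K" for \<alpha>
    unfolding Q_def using subspace_K CK by (simp add: subspace_sum subspace_scale)
  have QV: "Q \<alpha> \<in> V" for \<alpha> using QK K_in by blast
  have delta: "(\<Sum>c\<in>C. \<alpha> c * (if c = c' then 1 else 0)) = \<alpha> c'"
    if "c' \<in> C" for \<alpha> :: "'v \<Rightarrow> real" and c'
  proof -
    have "(\<Sum>c\<in>C. \<alpha> c * (if c = c' then 1 else 0)) = (\<Sum>c\<in>C. if c = c' then \<alpha> c else 0)"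
      by (rule sum.cong) auto
    then show ?thesis using that C'(1) by simp
  qed
  have P_C: "g (P \<alpha>) c = \<alpha> c" if "c \<in> C" for \<alpha> c
  proof -
    have "g (P \<alpha>) c = (\<Sum>c'\<in>C. \<alpha> c' * g (e c') c)"
      unfolding P_def using eV CV[OF that] by (rule form_sum(1))
    also have "\<dots> = (\<Sum>c'\<in>C. \<alpha> c' * (if c' = c then 1 else 0))"
      by (rule sum.cong) (use eC that in auto)
    finally show ?thesis using delta[OF that] by simp
  qed
  have Q_e: "g (Q \<alpha>) (e c) = \<alpha> c" if "c \<in> C" for \<alpha> c
  proof -
    have "g (Q \<alpha>) (e c) = (\<Sum>c'\<in>C. \<alpha> c' * g c' (e c))"
      unfolding Q_def using CV eV[OF that] by (rule form_sum(1))
    also have "\<dots> = (\<Sum>c'\<in>C. \<alpha> c' * (if c' = c then 1 else 0))"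
      by (rule sum.cong) (use eC that form_commute CV eV in auto)
    finally show ?thesis using delta[OF that] by simp
  qed
  have P_e: "g (P \<alpha>) (e c) = 0" if "c \<in> C" for \<alpha> c
    unfolding P_def using that eV ee by (simp add: form_sum)
  have Q_C: "g (Q \<alpha>) c = 0" if "c \<in> C" for \<alpha> c
    using iso QK CK that by blast
  \<comment> \<open>The difference is orthogonal to \<open>C\<close>, hence to \<open>K\<close>;
    maximality of the isotropic space \<open>K\<close> then puts it into \<open>K\<close>. This
    yields the decomposition of \<open>V\<close> without comparing dimensions.\<close>
  have diff_K: "v - P (g v) \<in> K" if v: "v \<in> V" for v
  proof (rule orthogonal_kernel[OF skew])
    show vV: "v - P (g v) \<in> V" using v PV sub by (simp add: subspace_diff)
    fix k assume "k \<in> K"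
    then obtain \<alpha> where "k = Q \<alpha>" using C'(1,3) by (auto simp: Q_def span_finite)
    moreover have "g (v - P (g v)) (Q \<alpha>) = 0"
      unfolding Q_def using CV vV v PV P_C by (simp add: form_sum form_diff)
    ultimately show "g (v - P (g v)) k = 0" by simp
  qed
  have expand: "v = P (g v) + Q (\<lambda>c. g v (e c))" if v: "v \<in> V" for v
  proof -
    obtain \<alpha> where \<alpha>: "v - P (g v) = Q \<alpha>"
      using diff_K[OF v] C'(1,3) by (auto simp: Q_def span_finite)
    have "\<alpha> c = g v (e c)" if "c \<in> C" for c
      using Q_e[OF that, of \<alpha>] P_e[OF that] v PV eV[OF that] by (simp add: \<alpha>[symmetric] form_diff)
    then have "Q \<alpha> = Q (\<lambda>c. g v (e c))" unfolding Q_def by (intro sum.cong) auto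
    then show ?thesis using \<alpha> by (simp add: algebra_simps)
  qed

  define B where "B = e ` C"
  define W where "W = span B"
  have inj_e: "inj_on e C"
  proof
    fix c c' assume c: "c \<in> C" "c' \<in> C" "e c = e c'"
    show "c = c'" using eC[OF c(1,2)] eC[OF c(2,2)] c(3) by (auto split: if_splits)
  qed
  have sum_B: "(\<Sum>b\<in>B. \<phi> b) = (\<Sum>c\<in>C. \<phi> (e c))" for \<phi> :: "'v \<Rightarrow> 'b::comm_monoid_add"
    unfolding B_def by (simp add: sum.reindex inj_e)
  have finB: "finite B" using C' by (simp add: B_def)
  have indB: "independent B"
    unfolding dependent_finite[OF finB]
  proof safe
    fix u c assume u: "(\<Sum>b\<in>B. u b *\<^sub>R b) = 0" "u c \<noteq> 0" "c \<in> B"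
    then obtain c' where c': "c' \<in> C" "c = e c'" by (auto simp: B_def)
    have "P (u \<circ> e) = 0" using u(1) sum_B[of "\<lambda>b. u b *\<^sub>R b"] by (simp add: P_def)
    then show False using P_C[OF c'(1), of "u \<circ> e"] u(2) c' CV by (simp add: form_zero)
  qed
  have basis: "finite_basis W B" using finB indB by (simp add: finite_basis_def W_def)
  have WV: "W \<subseteq> V" unfolding W_def B_def using sub eV by (intro span_minimal) auto
  have PW: "P \<alpha> \<in> W" for \<alpha>
    unfolding P_def W_def B_def by (intro span_sum span_scale span_base) auto
  have W_eq: "w = P (\<lambda>c. representation B w (e c))" if "w \<in> W" for w
    using sum_representation_eq[OF indB _ finB order_refl, of w] that
      sum_B[of "\<lambda>b. representation B w b *\<^sub>R b"] by (simp add: W_def P_def)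
  have rep: "representation B w (e c) = g w c" if "w \<in> W" "c \<in> C" for w c
    using P_C[OF that(2), of "\<lambda>c. representation B w (e c)"] W_eq[OF that(1)] by simp

  \<comment> \<open>The barred space of the doubled model is a copy of \<open>W\<close>, so the
    kernel component \<open>Q (\<lambda>c. g v (e c))\<close> is transported to it by sending each
    \<open>c\<close> to \<open>e c\<close>.\<close>
  define f where "f v = (P (g v), P (\<lambda>c. g v (e c)))" for v
  have form_f: "form_of (doubled_model W A B) (f x) (f y) = g x y" if "x \<in> V" "y \<in> V" for x y
  proof -
    have "form_of (doubled_model W A B) (f x) (f y) =
        (\<Sum>c\<in>C. g x c * g y (e c) + g x (e c) * g y c)"
      unfolding doubled_model_def using PW P_C by (simp add: sum_B rep f_def)
    also have "\<dots> = g (P (g x)) y + g (Q (\<lambda>c. g x (e c))) y"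
    proof -
      have "g (P (g x)) y = (\<Sum>c\<in>C. g x c * g (e c) y)"
        unfolding P_def using eV \<open>y \<in> V\<close> by (rule form_sum(1))
      moreover have "g (Q (\<lambda>c. g x (e c))) y = (\<Sum>c\<in>C. g x (e c) * g c y)"
        unfolding Q_def using CV \<open>y \<in> V\<close> by (rule form_sum(1))
      moreover have "g (e c) y = g y (e c)" "g c y = g y c" if "c \<in> C" for c
        using form_commute eV CV that \<open>y \<in> V\<close> by blast+
      ultimately show ?thesis by (simp add: sum.distrib)
    qed
    also have "\<dots> = g x y"
      using expand[OF that(1)] form_add(1)[OF PV QV that(2)] by metis
    finally show ?thesis .
  qed
  have lin: "linear_on_subspace V f"
    unfolding linear_on_subspace_def f_def P_def using CV eV
    by (simp add: form_add form_scale scaleR_add_left sum.distrib scaleR_sum_right)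
  have bij: "bij_betw f V (W \<times> W)"
  proof (rule bij_betw_imageI)
    show "inj_on f V"
    proof
      fix x y assume xy: "x \<in> V" "y \<in> V" "f x = f y"
      have "g x c = g y c" "g x (e c) = g y (e c)" if "c \<in> C" for c
        using P_C[OF that] xy(3) by (metis f_def prod.inject)+
      then have "P (g x) = P (g y)" "Q (\<lambda>c. g x (e c)) = Q (\<lambda>c. g y (e c))"
        unfolding P_def Q_def by (auto intro!: sum.cong)
      then show "x = y" using expand[OF xy(1)] expand[OF xy(2)] by simp
    qed
    show "f ` V = W \<times> W"
    proof
      show "f ` V \<subseteq> W \<times> W" using PW by (auto simp: f_def)
      show "W \<times> W \<subseteq> f ` V"
      proof safe
        fix w w' assume w: "w \<in> W" "w' \<in> W"
        \<comment> \<open>For \<open>w'\<close> in \<open>W\<close> the numbers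
          \<open>g w' c\<close> are its coordinates in the family \<open>e\<close>; \<open>Q\<close>
          carries them back to the kernel.\<close>
        let ?v = "P (g w) + Q (g w')"
        have "g ?v c = g w c" "g ?v (e c) = g w' c" if "c \<in> C" for c
          using that PV QV CV eV P_C P_e Q_C Q_e by (simp_all add: form_add)
        then have "P (g ?v) = P (g w)" "P (\<lambda>c. g ?v (e c)) = P (g w')"
          unfolding P_def by (auto intro!: sum.cong)
        moreover have "P (g w) = w" "P (g w') = w'"
          using W_eq[OF w(1)] W_eq[OF w(2)] rep w unfolding P_def by (auto intro!: sum.cong)
        ultimately have "f ?v = (w, w')" by (simp add: f_def)
        moreover have "?v \<in> V" using PV QV sub by (simp add: subspace_add)
        ultimately show "(w, w') \<in> f ` V" by (metis imageI)
      qed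
    qed
  qed
  have "curv_of (doubled_model W A B) (f x) (f y) (f z) (f w) = A x y z w"
    if "x \<in> V" "y \<in> V" "z \<in> V" "w \<in> V" for x y z w
    using curv_diff_K[OF that PV PV PV PV diff_K diff_K diff_K diff_K] that
    by (simp add: doubled_model_def f_def)
  moreover have "space_of (doubled_model W A B) = W \<times> W" by (simp add: doubled_model_def)
  ultimately have "isomorphic_models M (doubled_model W A B)"
    unfolding isomorphic_models_def using lin bij form_f by (intro exI[of _ f]) simp
  with that WV basis show thesis by blast
qed

end

section \<open>Doubled models\<close>

text \<open>The Euclidean inner product on \<open>W\<close> for which \<open>B\<close> is
  orthonormal. It identifies the barred copy with the dual of \<open>W\<close>, and as a
  non-degenerate form it gives access to the results on representation and orthogonal
  complements.\<close>

definition basis_pairing :: "'w::real_vector set \<Rightarrow> 'w form2" where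
  "basis_pairing B x y = (\<Sum>b\<in>B. representation B x b * representation B y b)"

lemma basis_pairing_self:
  assumes B: "finite_basis W B" and x: "x \<in> W" "x \<noteq> 0"
  shows "basis_pairing B x x \<noteq> 0"
proof
  assume "basis_pairing B x x = 0"
  then have "\<forall>b\<in>B. representation B x b = 0"
    using B by (simp add: basis_pairing_def finite_basis_def sum_nonneg_eq_0_iff)
  then have "(\<Sum>b\<in>B. representation B x b *\<^sub>R b) = 0" by simp
  then show False
    using B x sum_representation_eq[of B x B] by (simp add: finite_basis_def)
qed

lemma scalar_product_space_basis_pairing:
  assumes B: "finite_basis W B"
  shows "scalar_product_space W (basis_pairing B)"
proof
  have B': "finite B" "independent B" "span B = W" using B by (simp_all add: finite_basis_def)
  then show "fin_dim_subspace W" unfolding fin_dim_subspace_def by (metis subspace_span)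
  have "linear_on_subspace W (basis_pairing B x)" for x
    using B' unfolding linear_on_subspace_def basis_pairing_def
    by (simp add: representation_add representation_scale algebra_simps sum.distrib sum_distrib_left)
  moreover have sym: "basis_pairing B x y = basis_pairing B y x" for x y
    by (simp add: basis_pairing_def mult.commute)
  moreover have "(\<lambda>x. basis_pairing B x y) = basis_pairing B y" for y
    using sym by blast
  moreover have "x = 0" if "x \<in> W" "\<forall>y\<in>W. basis_pairing B x y = 0" for x
    using that basis_pairing_self[OF B] by blast
  ultimately show "inner_product_on W (basis_pairing B)"
    unfolding inner_product_on_def by simp
qed

text \<open>Fixing an isomorphism makes its components \<open>p\<close> and \<open>q\<close>
  coordinates on the model itself, so that the criteria for models apply directly; the barred space
  corresponds to the vectors with \<open>p x = 0\<close>.\<close>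

locale isomorphic_to_double = model M for M :: "'v::real_vector curv_model" +
  fixes W :: "'w::real_vector set" and A\<^sub>W :: "'w form4" and B :: "'w set"
    and f :: "'v \<Rightarrow> 'w \<times> 'w"
  assumes curv_W: "alg_curv_tensor W A\<^sub>W" and basis: "finite_basis W B"
    and f_linear: "linear_on_subspace (space_of M) f"
    and f_bij: "bij_betw f (space_of M) (W \<times> W)"
    and f_form: "\<And>x y. x \<in> space_of M \<Longrightarrow> y \<in> space_of M \<Longrightarrow>
      form_of (doubled_model W A\<^sub>W B) (f x) (f y) = form_of M x y"
    and f_curv: "\<And>x y z w. x \<in> space_of M \<Longrightarrow> y \<in> space_of M \<Longrightarrow> z \<in> space_of M \<Longrightarrow>
      w \<in> space_of M \<Longrightarrow>
      curv_of (doubled_model W A\<^sub>W B) (f x) (f y) (f z) (f w) = curv_of M x y z w"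
begin

sublocale B: scalar_product_space W "basis_pairing B"
  using basis by (rule scalar_product_space_basis_pairing)

sublocale W: curvature_space W A\<^sub>W
  using B.fin_dim curv_W by (rule curvature_space.intro)

abbreviation "p x \<equiv> fst (f x)"
abbreviation "q x \<equiv> snd (f x)"
abbreviation "E \<equiv> basis_pairing B"

lemma pq_in [simp]: "x \<in> V \<Longrightarrow> p x \<in> W" "x \<in> V \<Longrightarrow> q x \<in> W"
  using f_bij by (auto dest!: bij_betw_apply)

lemma pq_surj:
  assumes "w \<in> W" "w' \<in> W"
  obtains x where "x \<in> V" "p x = w" "q x = w'"
proof -
  have "(w, w') \<in> f ` V" using f_bij assms by (simp add: bij_betw_def)
  then show thesis using that by (metis fst_conv snd_conv imageE)
qed

lemma pq_add: "x \<in> V \<Longrightarrow> y \<in> V \<Longrightarrow> p (x + y) = p x + p y" "x \<in> V \<Longrightarrow> y \<in> V \<Longrightarrow> q (x + y) = q x + q y"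
  using f_linear by (simp_all add: linear_on_subspace_def)

lemma pq_scale: "x \<in> V \<Longrightarrow> p (c *\<^sub>R x) = c *\<^sub>R p x" "x \<in> V \<Longrightarrow> q (c *\<^sub>R x) = c *\<^sub>R q x"
  using f_linear by (simp_all add: linear_on_subspace_def)

lemma pq_zero: "p 0 = 0" "q 0 = 0"
  using linear_on_subspace_0[OF sub f_linear] by simp_all

lemma pq_inj: "x \<in> V \<Longrightarrow> y \<in> V \<Longrightarrow> p x = p y \<Longrightarrow> q x = q y \<Longrightarrow> x = y"
  using f_bij by (metis bij_betw_def inj_onD prod_eqI)

lemma form_pq: "x \<in> V \<Longrightarrow> y \<in> V \<Longrightarrow> g x y = E (p x) (q y) + E (q x) (p y)"
  using f_form[of x y] by (simp add: doubled_model_def basis_pairing_def sum.distrib)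

lemma curv_p:
  "x \<in> V \<Longrightarrow> y \<in> V \<Longrightarrow> z \<in> V \<Longrightarrow> w \<in> V \<Longrightarrow> A x y z w = A\<^sub>W (p x) (p y) (p z) (p w)"
  using f_curv[of x y z w] by (simp add: doubled_model_def)

text \<open>The curvature ignores barred components, so a curvature vector is orthogonal to every
  \<open>v\<close> with \<open>p v = 0\<close>. Against such \<open>v\<close> the form sees only the
  \<open>p\<close>-component of the curvature vector.\<close>

lemma p_curv_operator:
  assumes "x \<in> V" "y \<in> V" "z \<in> V"
  shows "p (curv_operator M x y z) = 0"
proof (rule B.form_nondegenerate)
  show "p (curv_operator M x y z) \<in> W" using assms by (simp add: curv_operator(1))
  fix w assume "w \<in> W"
  then obtain v where v: "v \<in> V" "p v = 0" "q v = w"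
    using pq_surj[of 0 w] B.sub by (auto simp: subspace_0)
  have "E (p (curv_operator M x y z)) w = g (curv_operator M x y z) v"
    using v assms by (simp add: form_pq curv_operator(1) B.form_zero)
  also have "\<dots> = 0"
    using v assms by (simp add: curv_operator(2) curv_p W.curv_zero)
  finally show "E (p (curv_operator M x y z)) w = 0" .
qed

lemma skew_nilpotent: "two_step_skew_curvature_nilpotent M"
  unfolding skew_nilpotent_iff
  by (simp add: curv_p curv_operator(1) p_curv_operator W.curv_zero)

section \<open>Splittings of the double and splittings of \<open>W\<close>\<close>

lemma indecomposable_curv_if_indecomposable_model:
  assumes ind: "indecomposable_model M"
  shows "indecomposable_curv W A\<^sub>W"
  unfolding W.indecomposable_curv_iff
proof
  assume "\<exists>W1 W2. is_direct_sum W W1 W2 \<and> W1 \<noteq> {0} \<and> W2 \<noteq> {0} \<and>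
    (\<forall>x\<in>W1. \<forall>y\<in>W2. \<forall>z\<in>W. \<forall>w\<in>W. A\<^sub>W x y z w = 0)"
  then obtain W1 W2 where W: "is_direct_sum W W1 W2" "W1 \<noteq> {0}" "W2 \<noteq> {0}"
    and 0: "\<And>x y z w. x \<in> W1 \<Longrightarrow> y \<in> W2 \<Longrightarrow> z \<in> W \<Longrightarrow> w \<in> W \<Longrightarrow> A\<^sub>W x y z w = 0"
    by blast
  have W12: "subspace W1" "subspace W2" "W1 \<inter> W2 = {0}"
    using W(1) by (simp_all add: is_direct_sum_def)
  have in1: "w \<in> W" if "w \<in> W1" for w using that is_direct_sum_subset[OF W(1)] by blast
  have in2: "w \<in> W" if "w \<in> W2" for w using that is_direct_sum_subset[OF W(1)] by blast
  \<comment> \<open>The second component ranges over the annihilator of the other summand, which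
    represents the dual of the first one. This choice makes \<open>U W1 W2\<close> and
    \<open>U W2 W1\<close> orthogonal even when \<open>W1\<close> and \<open>W2\<close> are not
    orthogonal for \<open>E\<close>.\<close>
  define U where "U W1 W2 = {v \<in> V. p v \<in> W1 \<and> (\<forall>w\<in>W2. E (q v) w = 0)}" for W1 W2
  have subU: "subspace (U X Y)" if "subspace X" "Y \<subseteq> W" for X Y
    using that sub unfolding U_def subspace_def
    by (auto simp: pq_zero pq_add pq_scale B.form_zero B.form_add B.form_scale subset_iff)
  have ne: "U X Y \<noteq> {0}" if X: "X \<noteq> {0}" "subspace X" "X \<subseteq> W" and Y: "Y \<subseteq> W" for X Y
  proof -
    obtain w where w: "w \<in> X" "w \<noteq> 0" using X subspace_0[OF X(2)] by blast
    then obtain v where v: "v \<in> V" "p v = w" "q v = 0"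
      using pq_surj[of w 0] X(3) B.sub subspace_0 by blast
    then have "v \<in> U X Y" using w Y by (auto simp: U_def B.form_zero)
    moreover have "v \<noteq> 0" using v w pq_zero by auto
    ultimately show ?thesis by blast
  qed
  have int: "v = 0" if v: "v \<in> U W1 W2" "v \<in> U W2 W1" for v
  proof -
    have v': "v \<in> V" "p v = 0" using v W12(3) by (auto simp: U_def)
    have "q v = 0"
    proof (rule B.form_nondegenerate)
      show "q v \<in> W" using v' by simp
      fix w assume "w \<in> W"
      with W(1) obtain a b where "a \<in> W1" "b \<in> W2" "w = a + b"
        by (rule is_direct_sum_decompose)
      then show "E (q v) w = 0" using v v' in1 in2 by (auto simp: U_def B.form_add)
    qed
    then show "v = 0" using v' pq_inj[of v 0] sub by (simp add: pq_zero subspace_0)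
  qed
  have decomp: "\<exists>x\<in>U W1 W2. \<exists>y\<in>U W2 W1. v = x + y" if v: "v \<in> V" for v
  proof -
    have "p v \<in> W" using v by simp
    with W(1) obtain w1 w2 where w: "w1 \<in> W1" "w2 \<in> W2" "p v = w1 + w2"
      by (rule is_direct_sum_decompose)
    have "q v \<in> W" using v by simp
    then obtain a b where ab: "a \<in> W" "b \<in> W" "q v = a + b"
      "\<And>x. x \<in> W2 \<Longrightarrow> E a x = 0" "\<And>x. x \<in> W1 \<Longrightarrow> E b x = 0"
      using B.dual_decomposition[OF W(1)] by metis
    obtain x where x: "x \<in> V" "p x = w1" "q x = a" using pq_surj in1[OF w(1)] ab(1) .
    obtain y where y: "y \<in> V" "p y = w2" "q y = b" using pq_surj in2[OF w(2)] ab(2) .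
    have "v = x + y"
      using pq_inj[of v "x + y"] v x y w ab(3) sub by (simp add: pq_add subspace_add)
    moreover have "x \<in> U W1 W2" "y \<in> U W2 W1" using x y w ab by (simp_all add: U_def)
    ultimately show ?thesis by blast
  qed
  have "is_direct_sum V (U W1 W2) (U W2 W1)"
  proof (rule is_direct_sumI)
    show "subspace (U W1 W2)" "subspace (U W2 W1)"
      using subU W12 in1 in2 by (simp_all add: subset_iff)
    show "x + y \<in> V" if "x \<in> U W1 W2" "y \<in> U W2 W1" for x y
      using that sub by (simp add: U_def subspace_add)
  qed (fact int decomp)+
  moreover have "U W1 W2 \<noteq> {0}" "U W2 W1 \<noteq> {0}"
    using ne W(2,3) W12 is_direct_sum_subset[OF W(1)] by simp_all
  moreover have "g x y = 0" if "x \<in> U W1 W2" "y \<in> U W2 W1" for x y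
    using that in1 in2 B.form_commute[of "p x" "q y"] by (simp add: U_def form_pq)
  moreover have "A x y z w = 0" if "x \<in> U W1 W2" "y \<in> U W2 W1" "z \<in> V" "w \<in> V" for x y z w
    using that 0 by (simp add: U_def curv_p)
  ultimately show False by (rule indecomposable_modelD[OF ind])
qed

text \<open>Over a line the image of \<open>f\<close> is spanned by the two vectors
  \<open>(w, 0)\<close> and \<open>(0, w)\<close>, too few for an injective image of
  \<open>V\<close>.\<close>

lemma not_line:
  assumes dim: "dim V \<ge> 3" and w: "w \<in> W"
  shows "W \<noteq> span {w}"
proof
  assume W: "W = span {w}"
  obtain C where C: "finite_basis V C" "card C = dim V" using finite_basis_exists[OF fin_dim] .
  then have C': "independent C" "span C = V" by (simp_all add: finite_basis_def)
  obtain h where h: "linear h" "\<And>x. x \<in> V \<Longrightarrow> h x = f x"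
    using linear_on_subspace_extend[OF sub f_linear] by blast
  have inj: "inj_on h (span C)"
    using f_bij h(2) unfolding C' by (metis bij_betw_def inj_on_cong)
  have "h x \<in> span {(w, 0), (0, w)}" if "x \<in> V" for x
  proof -
    have "p x \<in> span {w}" "q x \<in> span {w}" using pq_in[of x] that W by simp_all
    then obtain a b where "p x = a *\<^sub>R w" "q x = b *\<^sub>R w"
      by (auto simp: span_singleton)
    then have "h x = a *\<^sub>R (w, 0) + b *\<^sub>R (0, w)" using h(2)[OF that] by (simp add: prod_eq_iff)
    moreover have "a *\<^sub>R (w, 0) + b *\<^sub>R (0, w) \<in> span {(w, 0), (0, w)}"
      by (intro span_add span_scale span_base) simp_all
    ultimately show ?thesis by (rule ssubst)
  qed
  then have "h ` C \<subseteq> span {(w, 0), (0, w)}" using C'(2) span_base by blast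
  then have "card (h ` C) \<le> card {(w, 0), (0, w)}"
    using independent_span_bound[OF _ linear_independent_injective_image[OF h(1) C'(1) inj]] by simp
  \<comment> \<open>Only an inequality, because the two vectors coincide when \<open>w\<close> is
    zero.\<close>
  also have "\<dots> \<le> 2" by (simp add: card_insert_if)
  finally have "card (h ` C) \<le> 2" .
  moreover have "card (h ` C) = card C"
    by (rule card_image) (meson inj inj_on_subset span_superset)
  ultimately show False using C(2) dim by simp
qed

text \<open>As \<open>E\<close> is positive definite, a nonzero kernel vector is non-null and splits
  off its line from \<open>W\<close>; the complement is nonzero because \<open>W\<close> is not a
  line. The orthogonality for \<open>E\<close> serves only to produce a complement.\<close>

lemma kernel_trivial:
  assumes dim: "dim V \<ge> 3" and ind: "indecomposable_curv W A\<^sub>W" and k: "k \<in> W"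
    and 0: "\<And>x y z. x \<in> W \<Longrightarrow> y \<in> W \<Longrightarrow> z \<in> W \<Longrightarrow> A\<^sub>W k x y z = 0"
  shows "k = 0"
proof (rule ccontr)
  assume "k \<noteq> 0"
  then have k0: "E k k \<noteq> 0" using basis_pairing_self[OF basis k] by blast
  have "A\<^sub>W x y z w = 0" if "x \<in> span {k}" "y \<in> {v \<in> W. E k v = 0}" "z \<in> W" "w \<in> W" for x y z w
    using that 0 k by (auto simp: span_singleton W.curv_scale)
  moreover have "span {k} \<noteq> {0}" using \<open>k \<noteq> 0\<close> span_base[of k "{k}"] by auto
  ultimately show False
    using W.indecomposable_curvD[OF ind B.non_null_direct_sum[OF k k0]]
      B.orthogonal_nontrivial[OF k k0 not_line[OF dim k]] by blast
qed

lemma indecomposable_model_if_indecomposable_curv: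
  assumes dim: "dim V \<ge> 3" and ind: "indecomposable_curv W A\<^sub>W"
  shows "indecomposable_model M"
  unfolding indecomposable_model_iff
proof
  assume "\<exists>V1 V2. is_direct_sum V V1 V2 \<and> V1 \<noteq> {0} \<and> V2 \<noteq> {0} \<and>
        (\<forall>x\<in>V1. \<forall>y\<in>V2. g x y = 0) \<and> (\<forall>x\<in>V1. \<forall>y\<in>V2. \<forall>z\<in>V. \<forall>w\<in>V. A x y z w = 0)"
  then obtain V1 V2 where V: "is_direct_sum V V1 V2" "V1 \<noteq> {0}" "V2 \<noteq> {0}"
    and orth: "\<And>x y. x \<in> V1 \<Longrightarrow> y \<in> V2 \<Longrightarrow> g x y = 0"
    and 0: "\<And>x y z w. x \<in> V1 \<Longrightarrow> y \<in> V2 \<Longrightarrow> z \<in> V \<Longrightarrow> w \<in> V \<Longrightarrow> A x y z w = 0"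
    by blast
  have V12: "subspace V1" "subspace V2" using V(1) by (simp_all add: is_direct_sum_def)
  have in1: "v \<in> V" if "v \<in> V1" for v using that is_direct_sum_subset[OF V(1)] by blast
  have in2: "v \<in> V" if "v \<in> V2" for v using that is_direct_sum_subset[OF V(1)] by blast
  have decomp: "\<exists>a\<in>V1. \<exists>b\<in>V2. v = a + b" if "v \<in> V" for v
    using is_direct_sum_decompose[OF V(1) that] by metis
  have surj: "\<exists>v\<in>V. p v = w" if w: "w \<in> W" for w
    using pq_surj[OF w w] by blast
  have sub_image: "subspace (p ` X)" if X: "subspace X" "X \<subseteq> V" for X
    unfolding subspace_def
  proof (intro conjI ballI allI)
    show "0 \<in> p ` X" using pq_zero subspace_0[OF X(1)] by (metis imageI)
    fix a b c assume "a \<in> p ` X"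
    then obtain x where x: "x \<in> X" "a = p x" by blast
    then show "c *\<^sub>R a \<in> p ` X"
      using X by (intro image_eqI[of _ _ "c *\<^sub>R x"]) (auto simp: pq_scale subspace_scale)
    assume "b \<in> p ` X"
    then obtain y where "y \<in> X" "b = p y" by blast
    then show "a + b \<in> p ` X"
      using X x by (intro image_eqI[of _ _ "x + y"]) (auto simp: pq_add subspace_add subset_iff)
  qed
  \<comment> \<open>Such a \<open>p x\<close> lies in the kernel of \<open>A\<^sub>W\<close>. Lift
    the second argument and split it along \<open>V1\<close> and \<open>V2\<close>: its part in
    \<open>V2\<close> gives zero against \<open>x\<close>, and against its part in \<open>V1\<close>
    the vector \<open>x\<close> may be replaced by \<open>y\<close>, since the curvature depends
    only on \<open>p\<close>.\<close>
  have int: "p x = 0" if x: "x \<in> V1" and y: "y \<in> V2" and xy: "p x = p y" for x y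
  proof (rule kernel_trivial[OF dim ind])
    show "p x \<in> W" using in1[OF x] by simp
    fix a b c assume "a \<in> W" "b \<in> W" "c \<in> W"
    then obtain a' b' c' where abc: "a' \<in> V" "b' \<in> V" "c' \<in> V" "a = p a'" "b = p b'" "c = p c'"
      using surj by metis
    obtain a1 a2 where a: "a1 \<in> V1" "a2 \<in> V2" "a' = a1 + a2" using decomp abc(1) by blast
    note [simp] = in1[OF x] in2[OF y] in1[OF a(1)] in2[OF a(2)] abc(2,3)
    have "A\<^sub>W (p x) a b c = A x a1 b' c' + A x a2 b' c'"
      using abc a by (simp add: curv_p[symmetric] curv_add)
    also have "A x a2 b' c' = 0" using 0 x a by simp
    also have "A x a1 b' c' = A y a1 b' c'" using xy by (simp add: curv_p)
    also have "\<dots> = 0" using 0[OF a(1) y, of b' c'] curv_skew[of y a1 b' c'] by simp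
    finally show "A\<^sub>W (p x) a b c = 0" by simp
  qed
  have ne: "p ` X \<noteq> {0}"
    if X: "X \<noteq> {0}" "0 \<in> X" "X \<subseteq> V" and Y: "Y \<subseteq> V" and XY: "\<And>v. v \<in> V \<Longrightarrow> \<exists>a\<in>X. \<exists>b\<in>Y. v = a + b"
      "\<And>x y. x \<in> X \<Longrightarrow> y \<in> Y \<Longrightarrow> g x y = 0" for X Y
  proof
    assume pX: "p ` X = {0}"
    have "x = 0" if x: "x \<in> X" for x
    proof (rule form_nondegenerate)
      show "x \<in> V" using x X by blast
      fix v assume "v \<in> V"
      then obtain a b where ab: "a \<in> X" "b \<in> Y" "v = a + b" using XY by blast
      have V': "x \<in> V" "a \<in> V" "b \<in> V" using x ab X(3) Y by auto
      have "p x = 0" "p a = 0" using pX x ab by blast+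
      \<comment> \<open>Both terms of the form contain a \<open>p\<close>-component, so the form
        vanishes on the kernel of \<open>p\<close>.\<close>
      then have "g x a = 0" using V' by (simp add: form_pq B.form_zero)
      then show "g x v = 0" using XY(2)[OF x ab(2)] V' ab(3) by (simp add: form_add)
    qed
    then show False using X by blast
  qed
  have "is_direct_sum W (p ` V1) (p ` V2)"
  proof (rule is_direct_sumI)
    show "subspace (p ` V1)" "subspace (p ` V2)"
      using sub_image V12 is_direct_sum_subset[OF V(1)] by blast+
    show "x = 0" if "x \<in> p ` V1" "x \<in> p ` V2" for x
      using that int by auto
    show "a + b \<in> W" if "a \<in> p ` V1" "b \<in> p ` V2" for a b
      using that in1 in2 B.sub by (auto intro!: subspace_add)
    fix w assume "w \<in> W"
    then obtain v where v: "v \<in> V" "p v = w" using surj by blast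
    obtain a b where ab: "a \<in> V1" "b \<in> V2" "v = a + b" using decomp v(1) by blast
    then have "w = p a + p b" using v(2) in1 in2 by (simp add: pq_add)
    then show "\<exists>a\<in>p ` V1. \<exists>b\<in>p ` V2. w = a + b" using ab(1,2) by blast
  qed
  moreover have "p ` V1 \<noteq> {0}"
    by (rule ne[OF V(2) subspace_0[OF V12(1)] is_direct_sum_subset[OF V(1)] decomp orth])
  moreover have "p ` V2 \<noteq> {0}"
  proof (rule ne[OF V(3) subspace_0[OF V12(2)] is_direct_sum_subset(2,1)[OF V(1)]])
    show "\<exists>a\<in>V2. \<exists>b\<in>V1. v = a + b" if "v \<in> V" for v
      using decomp[OF that] by (metis add.commute)
    show "g x y = 0" if "x \<in> V2" "y \<in> V1" for x y
      using orth[OF that(2,1)] form_commute in1 in2 that by metis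
  qed
  moreover have "A\<^sub>W x y z w = 0"
    if xyzw: "x \<in> p ` V1" "y \<in> p ` V2" "z \<in> W" "w \<in> W" for x y z w
  proof -
    obtain z' w' where "z' \<in> V" "w' \<in> V" "z = p z'" "w = p w'" using surj xyzw(3,4) by metis
    then show ?thesis using xyzw(1,2) 0 in1 in2 by (auto simp: curv_p[symmetric])
  qed
  ultimately show False by (rule W.indecomposable_curvD[OF ind])
qed

end

section \<open>Equivalence of the three conditions\<close>

lemma isomorphic_to_double_if:
  assumes "is_model M" "alg_curv_tensor W A\<^sub>W" "finite_basis W B"
    "isomorphic_models M (doubled_model W A\<^sub>W B)"
  obtains f where "isomorphic_to_double M W A\<^sub>W B f"
proof -
  have "space_of (doubled_model W A\<^sub>W B) = W \<times> W" by (simp add: doubled_model_def)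
  then obtain f where "linear_on_subspace (space_of M) f" "bij_betw f (space_of M) (W \<times> W)"
    "\<forall>x\<in>space_of M. \<forall>y\<in>space_of M. form_of (doubled_model W A\<^sub>W B) (f x) (f y) = form_of M x y"
    "\<forall>x\<in>space_of M. \<forall>y\<in>space_of M. \<forall>z\<in>space_of M. \<forall>w\<in>space_of M.
       curv_of (doubled_model W A\<^sub>W B) (f x) (f y) (f z) (f w) = curv_of M x y z w"
    using assms(4) unfolding isomorphic_models_def by auto
  then have "isomorphic_to_double M W A\<^sub>W B f"
    using assms(1-3) unfolding isomorphic_to_double_def isomorphic_to_double_axioms_def model_def
    by blast
  with that show thesis .
qed

lemma double_imp_nilpotent_indecomposable:
  assumes "is_model M" "dim (space_of M) \<ge> 3" "is_indecomposable_double M W A\<^sub>W"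
  shows "two_step_jacobi_nilpotent M \<and> indecomposable_model M"
proof -
  obtain B where "finite_basis W B" "isomorphic_models M (doubled_model W A\<^sub>W B)"
    and W: "alg_curv_tensor W A\<^sub>W" "indecomposable_curv W A\<^sub>W"
    using assms(3) unfolding is_indecomposable_double_def by blast
  then obtain f where "isomorphic_to_double M W A\<^sub>W B f"
    using isomorphic_to_double_if[OF assms(1)] by metis
  then interpret isomorphic_to_double M W A\<^sub>W B f .
  show ?thesis
    using skew_nilpotent jacobi_nilpotent_iff_skew_nilpotent
      indecomposable_model_if_indecomposable_curv[OF assms(2) W(2)] by blast
qed

text \<open>An existential cannot range over types. The equivalence with the double is therefore
  stated for \<open>W\<close> in the type of \<open>M\<close>, where the construction finds it
  inside \<open>V\<close>, and the last conjunct gives the converse implication for a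
  \<open>W\<close> in an arbitrary type.\<close>

theorem theorem1p9:
  fixes M :: "'v::real_vector curv_model"
  assumes "is_model M" and "dim (space_of M) \<ge> 3"
  shows "((two_step_jacobi_nilpotent M \<and> indecomposable_model M) \<longleftrightarrow>
          (two_step_skew_curvature_nilpotent M \<and> indecomposable_model M)) \<and>
         ((two_step_jacobi_nilpotent M \<and> indecomposable_model M) \<longleftrightarrow>
          (\<exists>(W :: 'v set) A\<^sub>W. is_indecomposable_double M W A\<^sub>W)) \<and>
         ((\<exists>(W :: 'w::real_vector set) A\<^sub>W. is_indecomposable_double M W A\<^sub>W) \<longrightarrow>
          (two_step_jacobi_nilpotent M \<and> indecomposable_model M))"
proof -
  interpret model M using assms(1) by (rule model.intro)
  have to_double: "\<exists>(W :: 'v set) A\<^sub>W. is_indecomposable_double M W A\<^sub>W"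
    if skew: "two_step_skew_curvature_nilpotent M" and ind: "indecomposable_model M"
  proof -
    obtain W B where W: "W \<subseteq> V" "finite_basis W B" "isomorphic_models M (doubled_model W A B)"
      using isomorphic_double_if_skew_nilpotent[OF ind assms(2) skew] by blast
    have curv_W: "alg_curv_tensor W A" using alg_curv_tensor_subset[OF curv W(1)] .
    obtain f where "isomorphic_to_double M W A B f"
      using isomorphic_to_double_if[OF assms(1) curv_W W(2,3)] .
    then interpret D: isomorphic_to_double M W A B f .
    have "is_indecomposable_double M W A"
      unfolding is_indecomposable_double_def
      using D.B.fin_dim curv_W D.indecomposable_curv_if_indecomposable_model[OF ind] W(2,3)
      by blast
    then show ?thesis by blast
  qed
  show ?thesis
    using to_double jacobi_nilpotent_iff_skew_nilpotent
      double_imp_nilpotent_indecomposable[OF assms] by metis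
qed

end
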